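(* Let $\theta>0$ and $H\in(0,\frac12)$. For $T>0$ let $$f_T(t,s)=e^{-\theta|t-s|}\mathbf 1_{\{0\le s,t\le T\}},\qquad h_T(t,s)=e^{-\theta(T-t)-\theta(T-s)}\mathbf 1_{\{0\le s,t\le T\}}.$$ Then there is a constant $C$ independent of $T$ (depending only on $H$ and on the fixed parameter $\theta$) such that $$\big|\langle f_T,h_T\rangle_{\mathcal H^{\otimes 2}}\big|\le C .$$
   Context: Let $B^H=(B^H_t)_{t\in[0,T]}$ be fractional Brownian motion with Hurst parameter $H\in(0,\frac12)$, i.e. the centered Gaussian process with covariance $R_H(t,s)=\frac12(t^{2H}+s^{2H}-|t-s|^{2H})$. $\mathcal H$ denotes the associated real Hilbert space on $[0,T]$: the completion of the step functions on $[0,T]$ under the inner product determined by $\langle \mathbf 1_{[a,b)},\mathbf 1_{[c,d)}\rangle_{\mathcal H}=\mathbb E[(B^H_b-B^H_a)(B^H_d-B^H_c)]$; $\mathcal H^{\otimes 2}$ is its Hilbert-space tensor square, whose elements are identified with functions of two variables in $[0,T]$ through $(\phi\otimes\psi)(t,s)=\phi(t)\psi(s)$. *)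

theory Defs
  imports "HOL-Probability.Probability"
begin

definition fbm_cov :: "real \<Rightarrow> real \<Rightarrow> real \<Rightarrow> real" where
  "fbm_cov H t s = (t powr (2 * H) + s powr (2 * H) - \<bar>t - s\<bar> powr (2 * H)) / 2"

text \<open>
  An interval \<open>[a,b)\<close> is encoded by the pair \<open>(a, b)\<close>.
  \<open>interval_inner H (a, b) (c, d)\<close> is \<open>E[(B_b - B_a) (B_d - B_c)]\<close>
  for a fractional Brownian motion \<open>B\<close>; see \<open>interval_inner_eq_expectation\<close> below.
\<close>

definition interval_inner :: "real \<Rightarrow> real \<times> real \<Rightarrow> real \<times> real \<Rightarrow> real" where
  "interval_inner H I J =
     (case (I, J) of ((a, b), (c, d)) \<Rightarrow>
       fbm_cov H b d - fbm_cov H b c - fbm_cov H a d + fbm_cov H a c)"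

lemma (in prob_space) interval_inner_eq_expectation:
  fixes B :: "real \<Rightarrow> 'a \<Rightarrow> real"
  assumes meas: "\<And>t. t \<in> {0..T} \<Longrightarrow> B t \<in> borel_measurable M"
    and sq: "\<And>t. t \<in> {0..T} \<Longrightarrow> integrable M (\<lambda>\<omega>. (B t \<omega>)\<^sup>2)"
    and cov: "\<And>t s. t \<in> {0..T} \<Longrightarrow> s \<in> {0..T} \<Longrightarrow>
                expectation (\<lambda>\<omega>. B t \<omega> * B s \<omega>) = fbm_cov H t s"
    and in_range: "a \<in> {0..T}" "b \<in> {0..T}" "c \<in> {0..T}" "d \<in> {0..T}"
  shows "expectation (\<lambda>\<omega>. (B b \<omega> - B a \<omega>) * (B d \<omega> - B c \<omega>)) = interval_inner H (a, b) (c, d)"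
proof -
  have int: "integrable M (\<lambda>\<omega>. B t \<omega> * B s \<omega>)" if "t \<in> {0..T}" "s \<in> {0..T}" for t s
  proof (rule Bochner_Integration.integrable_bound[of M "\<lambda>\<omega>. (B t \<omega>)\<^sup>2 + (B s \<omega>)\<^sup>2"])
    show "integrable M (\<lambda>\<omega>. (B t \<omega>)\<^sup>2 + (B s \<omega>)\<^sup>2)"
      using sq that by simp
    show "(\<lambda>\<omega>. B t \<omega> * B s \<omega>) \<in> borel_measurable M"
      using meas that by simp
    show "AE \<omega> in M. norm (B t \<omega> * B s \<omega>) \<le> norm ((B t \<omega>)\<^sup>2 + (B s \<omega>)\<^sup>2)"
    proof (rule AE_I2)
      fix \<omega>
      have "2 * \<bar>B t \<omega>\<bar> * \<bar>B s \<omega>\<bar> \<le> (B t \<omega>)\<^sup>2 + (B s \<omega>)\<^sup>2"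
        using sum_squares_bound[of "\<bar>B t \<omega>\<bar>" "\<bar>B s \<omega>\<bar>"] by simp
      then have "2 * \<bar>B t \<omega> * B s \<omega>\<bar> \<le> \<bar>(B t \<omega>)\<^sup>2 + (B s \<omega>)\<^sup>2\<bar>"
        by (simp add: abs_mult)
      then show "norm (B t \<omega> * B s \<omega>) \<le> norm ((B t \<omega>)\<^sup>2 + (B s \<omega>)\<^sup>2)"
        unfolding real_norm_def by linarith
    qed
  qed
  have "expectation (\<lambda>\<omega>. (B b \<omega> - B a \<omega>) * (B d \<omega> - B c \<omega>)) =
        expectation (\<lambda>\<omega>. B b \<omega> * B d \<omega> - B b \<omega> * B c \<omega> - B a \<omega> * B d \<omega> + B a \<omega> * B c \<omega>)"
    by (simp add: algebra_simps)
  also have "\<dots> = interval_inner H (a, b) (c, d)"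
    using in_range by (simp add: int cov interval_inner_def)
  finally show ?thesis .
qed

text \<open>
  A list of triples \<open>(k, I, J)\<close> stands for the finite sum of the tensors
  \<open>k (1_I \<otimes> 1_J)\<close>, i.e. an element of the algebraic tensor square of the step
  functions. The step functions being dense in the Hilbert space of one variable, the completion
  of this algebraic tensor square is the Hilbert-space tensor square of that space.
\<close>

type_synonym step_tensor = "(real \<times> (real \<times> real) \<times> (real \<times> real)) list"

definition step_tensors :: "real \<Rightarrow> step_tensor set" where
  "step_tensors T =
     {xs. \<forall>(k, (a, b), (c, d)) \<in> set xs. 0 \<le> a \<and> a \<le> b \<and> b \<le> T \<and> 0 \<le> c \<and> c \<le> d \<and> d \<le> T}"

definition step_fun :: "step_tensor \<Rightarrow> real \<times> real \<Rightarrow> real" where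
  "step_fun xs = (\<lambda>(t, s). \<Sum>(k, (a, b), (c, d)) \<leftarrow> xs.
      k * (indicator {a..<b} t * indicator {c..<d} s))"

definition step_inner :: "real \<Rightarrow> step_tensor \<Rightarrow> step_tensor \<Rightarrow> real" where
  "step_inner H xs ys = (\<Sum>(k, I, J) \<leftarrow> xs. \<Sum>(k', I', J') \<leftarrow> ys.
      k * k' * (interval_inner H I I' * interval_inner H J J'))"

definition step_diff :: "step_tensor \<Rightarrow> step_tensor \<Rightarrow> step_tensor" where
  "step_diff xs ys = xs @ map (\<lambda>(k, I, J). (- k, I, J)) ys"

definition step_norm :: "real \<Rightarrow> step_tensor \<Rightarrow> real" where
  "step_norm H xs = sqrt (step_inner H xs xs)"

text \<open>
  Elements of the completion are classes of Cauchy sequences of step tensors. For \<open>H < 1/2\<close>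
  the norm dominates (up to a constant depending on \<open>T\<close>) the \<open>L\<^sup>2\<close> norm on
  \<open>[0,T]\<^sup>2\<close> and the resulting map into \<open>L\<^sup>2\<close> is injective, so the class of a
  Cauchy sequence is identified with the \<open>L\<^sup>2\<close> limit of its functions.
  The non-negative integral is used so that non-integrability of the square is not hidden by
  the convention that undefined integrals are zero.
\<close>

definition represents :: "real \<Rightarrow> real \<Rightarrow> (nat \<Rightarrow> step_tensor) \<Rightarrow> (real \<times> real \<Rightarrow> real) \<Rightarrow> bool" where
  "represents H T X f \<longleftrightarrow>
     (\<forall>n. X n \<in> step_tensors T) \<and>
     (\<forall>\<epsilon>>0. \<exists>N. \<forall>m\<ge>N. \<forall>n\<ge>N. step_norm H (step_diff (X m) (X n)) < \<epsilon>) \<and>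
     f \<in> borel_measurable (lebesgue_on ({0..T} \<times> {0..T})) \<and>
     (\<lambda>n. \<integral>\<^sup>+ p. ennreal ((f p - step_fun (X n) p)\<^sup>2) \<partial>lebesgue_on ({0..T} \<times> {0..T}))
       \<longlonglongrightarrow> 0"

definition tensor_square :: "real \<Rightarrow> real \<Rightarrow> (real \<times> real \<Rightarrow> real) set" where
  "tensor_square H T = {f. \<exists>X. represents H T X f}"

definition tensor_inner ::
    "real \<Rightarrow> real \<Rightarrow> (real \<times> real \<Rightarrow> real) \<Rightarrow> (real \<times> real \<Rightarrow> real) \<Rightarrow> real" where
  "tensor_inner H T f g =
     (THE r. \<exists>X Y. represents H T X f \<and> represents H T Y g \<and>
        (\<lambda>n. step_inner H (X n) (Y n)) \<longlonglongrightarrow> r)"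

definition f_kernel :: "real \<Rightarrow> real \<Rightarrow> real \<times> real \<Rightarrow> real" where
  "f_kernel \<theta> T = (\<lambda>(t, s). exp (- \<theta> * \<bar>t - s\<bar>) * indicator ({0..T} \<times> {0..T}) (t, s))"

definition h_kernel :: "real \<Rightarrow> real \<Rightarrow> real \<times> real \<Rightarrow> real" where
  "h_kernel \<theta> T = (\<lambda>(t, s).
      exp (- \<theta> * (T - t) - \<theta> * (T - s)) * indicator ({0..T} \<times> {0..T}) (t, s))"

end

theory Submission
  imports Defs
begin

text \<open>
  The bound. Write \<open>h = u \<otimes> u\<close> with \<open>u(t) = exp (- \<theta> (T - t))\<close>. The function \<open>u\<close> is increasing, hence a
  mixture of the indicators of the intervals \<open>[r,T)\<close>, and the mixing distribution puts mass
  \<open>exp (- \<theta> z)\<close> on \<open>T - r \<ge> z\<close> for \<open>z \<le> T\<close>. For \<open>H < 1/2\<close> the map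
  \<open>t \<mapsto> E[(B_t - B_0) (B_T - B_r)]\<close> decreases on \<open>[0,r]\<close> (disjoint increments are negatively
  correlated) and increases on \<open>[r,T]\<close>; reading off its values at \<open>0\<close>, \<open>r\<close> and \<open>T\<close> shows that its
  total variation is at most \<open>3/2 (T - r)^{2H} \<le> 3/2 (1 + (T - r))\<close>. Averaged over the mixture this
  is at most \<open>3/2 (1 + 1/\<theta>)\<close>, whatever \<open>T\<close> is. As \<open>0 \<le> f \<le> 1\<close>, the inner product of \<open>f\<close> with
  \<open>u \<otimes> u\<close> is at most the square of this number. The argument is carried out for discretised
  kernels (\<open>sum_abs_interval_inner_tail_le\<close>, \<open>step_inner_f_h_le\<close>), where it involves finite sums only,
  and passes to the limit.

  The Hilbert space. That limit has to be the tensor inner product, and for this the completion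
  is realised concretely. The Hartley transform, i.e. the Fourier transform with the real kernel
  \<open>cas = cos + sin\<close>, maps step functions isometrically, up to a constant, into \<open>L\<^sup>2\<close> of the measure
  \<open>|\<xi>|^{-1-2H} d\<xi>\<close>: by scaling, the squared distance of \<open>cas (t \<xi>)\<close> and \<open>cas (s \<xi>)\<close> there is a
  multiple of \<open>|t - s|^{2H}\<close>, and polarisation does the rest. Taking products of transforms, step
  tensors embed into \<open>L\<^sup>2\<close> of the product measure (\<open>integral_hartley_step_mult\<close>).
  At a fixed frequency the transform is continuous in \<open>L\<^sup>2([0,T]\<^sup>2)\<close>. Hence two Cauchy sequences with
  the same \<open>L\<^sup>2\<close> limit have transforms whose difference tends to zero pointwise, and Fatou's
  lemma upgrades this to convergence in norm (\<open>represents_unique\<close>): the inner product does not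
  depend on the representing sequences, and can be computed along any of them
  (\<open>tensor_inner_LIMSEQ\<close>). In the other direction, a sequence of step tensors converging
  uniformly, whose transforms are dominated by a fixed square integrable function, is Cauchy by
  dominated convergence (\<open>represents_by_uniform_approximation\<close>).

  Membership. For \<open>h\<close> the domination is clear, since its discretisation is a mixture of products of
  indicators. For \<open>f\<close> it follows from the discrete form of the stationary Ornstein-Uhlenbeck
  representation, \<open>q^|i-j| = \<Sum>k. w k * (1_{k\<le>i} q^{i-k}) (1_{k\<le>j} q^{j-k})\<close>
  (\<open>geometric_kernel_decomposition\<close>): this writes \<open>f\<close> as a superposition of products of
  one-variable functions of bounded variation with bounded total weight.
\<close>

section \<open>The Hartley transform of interval indicators\<close>

text \<open>
  The kernel of the Hartley transform. It plays the role of \<open>exp (i x)\<close> but is real valued, so that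
  products of two transforms stay real and no imaginary parts have to be tracked when two
  variables are combined.
\<close>

definition cas :: "real \<Rightarrow> real" where
  "cas x = cos x + sin x"

text \<open>
  Up to the factor \<open>\<xi>\<close> and the sign of the frequency, the Hartley transform of the indicator of \<open>[a,b)\<close>, see
  \<open>hartley_incr_eq_integral\<close> below. The factor is absorbed in the weight of
  the spectral measure, which therefore has the exponent \<open>-1-2H\<close> instead of \<open>1-2H\<close>.
\<close>

definition hartley_incr :: "real \<times> real \<Rightarrow> real \<Rightarrow> real" where
  "hartley_incr I \<xi> = cas (snd I * \<xi>) - cas (fst I * \<xi>)"

definition spectral_measure :: "real \<Rightarrow> real measure" where
  "spectral_measure H = density lborel (\<lambda>\<xi>. ennreal (\<bar>\<xi>\<bar> powr (- 1 - 2 * H)))"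

definition spectral_const :: "real \<Rightarrow> real" where
  "spectral_const H = (\<integral>\<xi>. 2 - 2 * cos \<xi> \<partial>spectral_measure H)"

lemma measurable_cas [measurable]: "cas \<in> borel_measurable borel"
  unfolding cas_def by measurable

lemma measurable_hartley_incr [measurable]: "hartley_incr I \<in> borel_measurable borel"
  unfolding hartley_incr_def by measurable

lemma sets_spectral_measure [simp, measurable_cong]: "sets (spectral_measure H) = sets borel"
  by (simp add: spectral_measure_def)

lemma space_spectral_measure [simp]: "space (spectral_measure H) = UNIV"
  by (simp add: spectral_measure_def)

lemma sigma_finite_spectral_measure: "sigma_finite_measure (spectral_measure H)"
  unfolding spectral_measure_def
  by (subst sigma_finite_measure.sigma_finite_iff_density_finite[OF sigma_finite_lborel]) auto

lemma abs_cas_le: "\<bar>cas x\<bar> \<le> 2"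
  unfolding cas_def using abs_cos_le_one[of x] abs_sin_le_one[of x] by linarith

lemma cas_has_real_derivative: "(cas has_real_derivative cas (- x)) (at x within S)"
  unfolding cas_def by (auto intro!: derivative_eq_intros)

lemma abs_cas_diff_le: "\<bar>cas x - cas y\<bar> \<le> 2 * \<bar>x - y\<bar>"
proof -
  have "norm (cas x - cas y) \<le> 2 * norm (x - y)"
    by (rule field_differentiable_bound[of UNIV cas "\<lambda>x. cas (- x)"])
       (auto intro: cas_has_real_derivative abs_cas_le)
  then show ?thesis by simp
qed

text \<open>
  The bound has to serve both ends of the spectrum: linear decay at \<open>\<xi> = 0\<close> compensates the
  singularity of the weight there, boundedness suffices at infinity.
\<close>

lemma abs_hartley_incr_le: "\<bar>hartley_incr (a, b) \<xi>\<bar> \<le> (4 + 2 * \<bar>b - a\<bar>) * min 1 \<bar>\<xi>\<bar>"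
proof -
  have 1: "\<bar>hartley_incr (a, b) \<xi>\<bar> \<le> 4"
    unfolding hartley_incr_def using abs_cas_le[of "b * \<xi>"] abs_cas_le[of "a * \<xi>"] by simp
  have "b * \<xi> - a * \<xi> = (b - a) * \<xi>" by (simp add: algebra_simps)
  then have 2: "\<bar>hartley_incr (a, b) \<xi>\<bar> \<le> 2 * \<bar>b - a\<bar> * \<bar>\<xi>\<bar>"
    unfolding hartley_incr_def using abs_cas_diff_le[of "b * \<xi>" "a * \<xi>"] by (simp add: abs_mult)
  show ?thesis
  proof (cases "\<bar>\<xi>\<bar> \<le> 1")
    case True
    then show ?thesis using 2 by (simp add: min_def algebra_simps)
  next
    case False
    have "4 \<le> 4 + 2 * \<bar>b - a\<bar>" by simp
    with 1 have "\<bar>hartley_incr (a, b) \<xi>\<bar> \<le> 4 + 2 * \<bar>b - a\<bar>" by (rule order_trans)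
    then show ?thesis using False by (simp add: min_def)
  qed
qed

lemma two_minus_cos_le: "2 - 2 * cos (x::real) \<le> x\<^sup>2"
proof -
  have "2 - 2 * cos x = (2 * sin (x/2))\<^sup>2" 
    using cos_double_sin[of "x/2"] by (simp add: power_mult_distrib)
  also have "\<dots> \<le> x\<^sup>2"
    using abs_sin_x_le_abs_x[of "x/2"] unfolding abs_le_square_iff[symmetric] by simp
  finally show ?thesis .
qed

lemma interval_inner_eq_increments:
  assumes "0 \<le> a" "0 \<le> b" "0 \<le> c" "0 \<le> d"
  shows "interval_inner H (a, b) (c, d) =
    (\<bar>b - c\<bar> powr (2 * H) + \<bar>a - d\<bar> powr (2 * H) - \<bar>b - d\<bar> powr (2 * H) - \<bar>a - c\<bar> powr (2 * H)) / 2"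
  by (simp add: interval_inner_def fbm_cov_def field_simps)

context
  fixes H :: real
  assumes H: "0 < H" "H < 1 / 2"
begin

text \<open>
  Every integrability claim about the spectral measure reduces to this one: near zero the integrand
  is \<open>|\<xi>|^{1-2H}\<close>, which is bounded because \<open>H < 1/2\<close>, and at infinity it is \<open>|\<xi>|^{-1-2H}\<close>, which is
  integrable because \<open>H > 0\<close>.
\<close>

lemma integrable_spectral_weight: "integrable (spectral_measure H) (\<lambda>\<xi>. (min 1 \<bar>\<xi>\<bar>)\<^sup>2)"
proof -
  have tail: "integrable lborel (\<lambda>x. indicator {1..} x * x powr (- 1 - 2 * H))"
  proof -
    have "((\<lambda>x. x powr (- 1 - 2 * H)) has_integral -(1 powr (- 1 - 2 * H + 1)) / (- 1 - 2 * H + 1)) {1..}"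
      using H by (intro has_integral_powr_to_inf) auto
    then have "integrable lebesgue (\<lambda>x. indicator {1..} x *\<^sub>R (x powr (- 1 - 2 * H)))"
      by (intro nonnegative_absolutely_integrable_1[unfolded set_integrable_def]) auto
    then show ?thesis by (subst (asm) integrable_completion) auto
  qed
  from lborel_integrable_real_affine[OF this, of "-1" 0]
  have tail': "integrable lborel (\<lambda>x. indicator {1..} (- x) * (- x) powr (- 1 - 2 * H))" by simp
  have mid: "integrable lborel (\<lambda>x. indicator {- 1..1::real} x :: real)"
    by (simp add: integrable_indicator_iff)
  have "integrable lborel (\<lambda>\<xi>. \<bar>\<xi>\<bar> powr (- 1 - 2 * H) *\<^sub>R (min 1 \<bar>\<xi>\<bar>)\<^sup>2)"
  proof (rule Bochner_Integration.integrable_bound[OF Bochner_Integration.integrable_add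
        [OF Bochner_Integration.integrable_add[OF tail tail'] mid]], goal_cases)
    case 2
    have "\<bar>\<xi>\<bar> powr (- 1 - 2 * H) * (min 1 \<bar>\<xi>\<bar>)\<^sup>2
        \<le> indicator {1..} \<xi> * \<xi> powr (- 1 - 2 * H) + indicator {1..} (- \<xi>) * (- \<xi>) powr (- 1 - 2 * H)
           + indicator {- 1..1} \<xi>" (is "?l \<le> ?r") for \<xi> :: real
    proof (cases "\<bar>\<xi>\<bar> \<le> 1")
      case True
      have "?l = \<bar>\<xi>\<bar> powr (- 1 - 2 * H) * \<bar>\<xi>\<bar> powr 2"
        using True by (cases "\<xi> = 0") (simp_all add: min_def powr_numeral)
      also have "\<dots> = \<bar>\<xi>\<bar> powr (1 - 2 * H)" by (subst powr_add[symmetric]) simp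
      also have "\<dots> \<le> 1" using True H powr_mono2[of "1 - 2 * H" "\<bar>\<xi>\<bar>" 1] by simp
      also have "\<dots> \<le> ?r" using True by (auto simp: indicator_def)
      finally show ?thesis .
    next
      case False
      then show ?thesis by (auto simp: indicator_def min_def abs_if)
    qed
    then show ?case by (intro AE_I2) (auto simp: abs_mult intro: order_trans)
  qed measurable
  then show ?thesis
    unfolding spectral_measure_def by (subst integrable_density) auto
qed

lemma integrable_of_spectral_bound:
  assumes [measurable]: "g \<in> borel_measurable borel"
    and "\<And>\<xi>. \<bar>g \<xi>\<bar> \<le> C * (min 1 \<bar>\<xi>\<bar>)\<^sup>2"
  shows "integrable (spectral_measure H) g"
proof (rule Bochner_Integration.integrable_bound[OF integrable_mult_right[OF integrable_spectral_weight, of C]])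
  show "g \<in> borel_measurable (spectral_measure H)" by measurable
  show "AE \<xi> in spectral_measure H. norm (g \<xi>) \<le> norm (C * (min 1 \<bar>\<xi>\<bar>)\<^sup>2)"
    using order_trans[OF assms(2) abs_ge_self] by (intro AE_I2) simp
qed

lemma integral_odd_spectral:
  fixes g :: "real \<Rightarrow> real"
  assumes [measurable]: "g \<in> borel_measurable borel" and odd: "\<And>\<xi>. g (- \<xi>) = - g \<xi>"
  shows "(\<integral>\<xi>. g \<xi> \<partial>spectral_measure H) = 0"
proof -
  have eq: "(\<integral>\<xi>. g \<xi> \<partial>spectral_measure H) = (\<integral>\<xi>. \<bar>\<xi>\<bar> powr (- 1 - 2 * H) * g \<xi> \<partial>lborel)"
    unfolding spectral_measure_def by (subst integral_density) auto
  also have "\<dots> = - (\<integral>\<xi>. \<bar>\<xi>\<bar> powr (- 1 - 2 * H) * g \<xi> \<partial>lborel)"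
    using lborel_integral_real_affine[of "-1" "\<lambda>\<xi>. \<bar>\<xi>\<bar> powr (- 1 - 2 * H) * g \<xi>" 0]
    by (simp add: odd)
  finally show ?thesis using eq by simp
qed

lemma integrable_two_minus_cos: "integrable (spectral_measure H) (\<lambda>\<xi>. 2 - 2 * cos (x * \<xi>))"
proof (rule integrable_of_spectral_bound)
  fix \<xi> :: real
  have b: "0 \<le> 2 - 2 * cos (x * \<xi>)" "2 - 2 * cos (x * \<xi>) \<le> 4"
    using cos_le_one[of "x * \<xi>"] cos_ge_minus_one[of "x * \<xi>"] by linarith+
  show "\<bar>2 - 2 * cos (x * \<xi>)\<bar> \<le> (4 + x\<^sup>2) * (min 1 \<bar>\<xi>\<bar>)\<^sup>2"
  proof (cases "\<bar>\<xi>\<bar> \<le> 1")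
    case True
    then show ?thesis using two_minus_cos_le[of "x * \<xi>"] b(1)
      by (simp add: min_def power_mult_distrib distrib_right add_increasing)
  next
    case False
    have "2 - 2 * cos (x * \<xi>) \<le> 4 + x\<^sup>2" using b(2) zero_le_power2[of x] by linarith
    then show ?thesis using False b(1) by (simp add: min_def)
  qed
qed measurable

text \<open>
  Substituting \<open>\<xi> / x\<close> for \<open>\<xi>\<close> turns the weight \<open>|\<xi>|^{-1-2H}\<close> into a power of \<open>x\<close>. This homogeneity is
  where the exponent \<open>2H\<close> of the covariance comes from.
\<close>

lemma integral_two_minus_cos:
  "(\<integral>\<xi>. 2 - 2 * cos (x * \<xi>) \<partial>spectral_measure H) = spectral_const H * \<bar>x\<bar> powr (2 * H)"
proof (cases "x = 0")
  case False
  let ?w = "\<lambda>\<xi>::real. \<bar>\<xi>\<bar> powr (- 1 - 2 * H)"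
  have "(\<integral>\<xi>. 2 - 2 * cos (x * \<xi>) \<partial>spectral_measure H) = (\<integral>\<xi>. ?w \<xi> * (2 - 2 * cos (x * \<xi>)) \<partial>lborel)"
    unfolding spectral_measure_def by (subst integral_density) auto
  also have "\<dots> = (\<integral>\<xi>. \<bar>x\<bar> powr (1 + 2 * H) * (?w (x * \<xi>) * (2 - 2 * cos (x * \<xi>))) \<partial>lborel)"
  proof (rule Bochner_Integration.integral_cong)
    fix \<xi>
    have "\<bar>x\<bar> powr (1 + 2 * H) * ?w (x * \<xi>) = \<bar>x\<bar> powr (1 + 2 * H) * \<bar>x\<bar> powr (- 1 - 2 * H) * ?w \<xi>"
      by (simp add: abs_mult powr_mult mult_ac)
    also have "\<bar>x\<bar> powr (1 + 2 * H) * \<bar>x\<bar> powr (- 1 - 2 * H) = 1"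
      using False by (simp flip: powr_add)
    finally show "?w \<xi> * (2 - 2 * cos (x * \<xi>)) = \<bar>x\<bar> powr (1 + 2 * H) * (?w (x * \<xi>) * (2 - 2 * cos (x * \<xi>)))"
      by simp
  qed simp
  also have "\<dots> = \<bar>x\<bar> powr (1 + 2 * H) * (\<integral>\<xi>. ?w (x * \<xi>) * (2 - 2 * cos (x * \<xi>)) \<partial>lborel)"
    by simp
  also have "(\<integral>\<xi>. ?w (x * \<xi>) * (2 - 2 * cos (x * \<xi>)) \<partial>lborel) = (\<integral>\<xi>. ?w \<xi> * (2 - 2 * cos \<xi>) \<partial>lborel) / \<bar>x\<bar>"
    using lborel_integral_real_affine[OF False, of "\<lambda>\<xi>. ?w \<xi> * (2 - 2 * cos \<xi>)" 0] False by simp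
  also have "(\<integral>\<xi>. ?w \<xi> * (2 - 2 * cos \<xi>) \<partial>lborel) = spectral_const H"
    unfolding spectral_const_def spectral_measure_def by (subst integral_density) auto
  also have "\<bar>x\<bar> powr (1 + 2 * H) * (spectral_const H / \<bar>x\<bar>) = spectral_const H * \<bar>x\<bar> powr (2 * H)"
    using False by (simp add: powr_add)
  finally show ?thesis .
qed simp

lemma spectral_const_pos: "spectral_const H > 0"
proof (rule ccontr)
  have nonneg: "0 \<le> 2 - 2 * cos (\<xi>::real)" for \<xi> by simp
  have int: "integrable (spectral_measure H) (\<lambda>\<xi>. 2 - 2 * cos \<xi>)"
    using integrable_two_minus_cos[of 1] by simp
  assume "\<not> spectral_const H > 0"
  moreover have "spectral_const H \<ge> 0" unfolding spectral_const_def
    by (intro Bochner_Integration.integral_nonneg nonneg)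
  ultimately have "spectral_const H = 0" by simp
  then have "AE \<xi> in spectral_measure H. 2 - 2 * cos \<xi> = 0"
    unfolding spectral_const_def by (subst (asm) integral_nonneg_eq_0_iff_AE[OF int]) auto
  then have "AE \<xi> in lborel. \<bar>\<xi>\<bar> powr (- 1 - 2 * H) > 0 \<longrightarrow> cos \<xi> = 1"
    unfolding spectral_measure_def by (subst (asm) AE_density) auto
  then have "AE \<xi> in lborel. \<xi> \<notin> {1..2::real}"
  proof eventually_elim
    case (elim \<xi>)
    show ?case
    proof
      assume \<xi>: "\<xi> \<in> {1..2}"
      then have "cos \<xi> < cos 0" using pi_gt3 by (intro cos_monotone_0_pi) auto
      then show False using elim \<xi> by simp
    qed
  qed
  then have "emeasure lborel {1..2::real} = 0"
    by (subst (asm) AE_iff_measurable[of "{1..2}"]) auto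
  then show False by simp
qed

text \<open>
  The square of \<open>cas x - cas y\<close> is \<open>|exp(ix) - exp(iy)|\<^sup>2 = 2 - 2 cos (x - y)\<close> up to terms that are odd in
  the frequency and integrate to zero.
\<close>

lemma integral_cas_diff_square:
  "integrable (spectral_measure H) (\<lambda>\<xi>. (cas (t * \<xi>) - cas (s * \<xi>))\<^sup>2)"
  "(\<integral>\<xi>. (cas (t * \<xi>) - cas (s * \<xi>))\<^sup>2 \<partial>spectral_measure H) = spectral_const H * \<bar>t - s\<bar> powr (2 * H)"
proof -
  define K where "K = 4 + 2 * \<bar>t - s\<bar>"
  have bound: "\<bar>(cas (t * \<xi>) - cas (s * \<xi>))\<^sup>2\<bar> \<le> K\<^sup>2 * (min 1 \<bar>\<xi>\<bar>)\<^sup>2" for \<xi>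
  proof -
    have "\<bar>cas (t * \<xi>) - cas (s * \<xi>)\<bar> \<le> K * min 1 \<bar>\<xi>\<bar>"
      using abs_hartley_incr_le[of s t \<xi>] by (simp add: hartley_incr_def K_def)
    then have "\<bar>cas (t * \<xi>) - cas (s * \<xi>)\<bar>\<^sup>2 \<le> (K * min 1 \<bar>\<xi>\<bar>)\<^sup>2" by (rule power_mono) simp
    then show ?thesis by (simp add: power_mult_distrib)
  qed
  show int: "integrable (spectral_measure H) (\<lambda>\<xi>. (cas (t * \<xi>) - cas (s * \<xi>))\<^sup>2)"
    by (rule integrable_of_spectral_bound[OF _ bound]) measurable
  define odd where "odd \<xi> = sin (2 * (t * \<xi>)) + sin (2 * (s * \<xi>)) - 2 * sin ((t + s) * \<xi>)" for \<xi>
  have [measurable]: "odd \<in> borel_measurable borel" unfolding odd_def by measurable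
  have split: "(cas (t * \<xi>) - cas (s * \<xi>))\<^sup>2 = (2 - 2 * cos ((t - s) * \<xi>)) + odd \<xi>" for \<xi>
  proof -
    have "(cas x - cas y)\<^sup>2 = 2 - 2 * cos (x - y) + (sin (2 * x) + sin (2 * y) - 2 * sin (x + y))" for x y
      unfolding cas_def sin_double cos_diff sin_add
      using sin_cos_squared_add3[of x] sin_cos_squared_add3[of y] by algebra
    from this[of "t * \<xi>" "s * \<xi>"] show ?thesis
      unfolding odd_def by (simp add: left_diff_distrib distrib_right)
  qed
  have "integrable (spectral_measure H) odd"
    using Bochner_Integration.integrable_diff[OF int integrable_two_minus_cos[of "t - s"]]
    by (simp add: split)
  moreover have "(\<integral>\<xi>. odd \<xi> \<partial>spectral_measure H) = 0"
    by (rule integral_odd_spectral) (simp_all add: odd_def)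
  ultimately show "(\<integral>\<xi>. (cas (t * \<xi>) - cas (s * \<xi>))\<^sup>2 \<partial>spectral_measure H) = spectral_const H * \<bar>t - s\<bar> powr (2 * H)"
    unfolding split by (subst Bochner_Integration.integral_add)
      (auto simp: integrable_two_minus_cos integral_two_minus_cos)
qed

text \<open>
  Polarisation: a product of two differences is a combination of the four squared differences
  between their terms, and so is the covariance of two increments.
\<close>

lemma integral_hartley_incr:
  assumes "0 \<le> a" "0 \<le> b" "0 \<le> c" "0 \<le> d"
  shows "integrable (spectral_measure H) (\<lambda>\<xi>. hartley_incr (a, b) \<xi> * hartley_incr (c, d) \<xi>)"
    and "(\<integral>\<xi>. hartley_incr (a, b) \<xi> * hartley_incr (c, d) \<xi> \<partial>spectral_measure H) =
           spectral_const H * interval_inner H (a, b) (c, d)"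
proof -
  let ?D = "\<lambda>t s \<xi>. (cas (t * \<xi>) - cas (s * \<xi>))\<^sup>2"
  have polar: "hartley_incr (a, b) \<xi> * hartley_incr (c, d) \<xi> =
      (?D b c \<xi> + ?D a d \<xi> - ?D b d \<xi> - ?D a c \<xi>) / 2" for \<xi>
    by (simp add: hartley_incr_def power2_eq_square field_simps)
  show "integrable (spectral_measure H) (\<lambda>\<xi>. hartley_incr (a, b) \<xi> * hartley_incr (c, d) \<xi>)"
    unfolding polar by (intro Bochner_Integration.integrable_add Bochner_Integration.integrable_diff
      integrable_divide integral_cas_diff_square)
  show "(\<integral>\<xi>. hartley_incr (a, b) \<xi> * hartley_incr (c, d) \<xi> \<partial>spectral_measure H) =
           spectral_const H * interval_inner H (a, b) (c, d)"
    unfolding polar interval_inner_eq_increments[OF assms]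
    by (simp only: integral_divide_zero Bochner_Integration.integral_add Bochner_Integration.integral_diff
          Bochner_Integration.integrable_add Bochner_Integration.integrable_diff integral_cas_diff_square)
       (simp add: algebra_simps)
qed

end

section \<open>The isometric embedding of step tensors\<close>

lemma (in pair_sigma_finite) integral_fst_mult_snd:
  fixes f :: "'a \<Rightarrow> real" and g :: "'b \<Rightarrow> real"
  assumes f: "integrable M1 f" and g: "integrable M2 g"
  shows "integrable (M1 \<Otimes>\<^sub>M M2) (\<lambda>p. f (fst p) * g (snd p))"
    and "(\<integral>p. f (fst p) * g (snd p) \<partial>(M1 \<Otimes>\<^sub>M M2)) = (\<integral>x. f x \<partial>M1) * (\<integral>y. g y \<partial>M2)"
proof -
  have [measurable]: "f \<in> borel_measurable M1" "g \<in> borel_measurable M2"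
    using f g by auto
  show int: "integrable (M1 \<Otimes>\<^sub>M M2) (\<lambda>p. f (fst p) * g (snd p))"
  proof (rule Fubini_integrable)
    show "integrable M1 (\<lambda>x. \<integral>y. norm (f (fst (x, y)) * g (snd (x, y))) \<partial>M2)"
      using f by (simp add: abs_mult)
    show "AE x in M1. integrable M2 (\<lambda>y. f (fst (x, y)) * g (snd (x, y)))"
      using g by simp
  qed measurable
  show "(\<integral>p. f (fst p) * g (snd p) \<partial>(M1 \<Otimes>\<^sub>M M2)) = (\<integral>x. f x \<partial>M1) * (\<integral>y. g y \<partial>M2)"
    using integral_fst'[OF int] by simp
qed

definition hartley_step :: "step_tensor \<Rightarrow> real \<times> real \<Rightarrow> real" where
  "hartley_step xs = (\<lambda>p. \<Sum>(k, I, J) \<leftarrow> xs. k * (hartley_incr I (fst p) * hartley_incr J (snd p)))"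

abbreviation spectral2 :: "real \<Rightarrow> (real \<times> real) measure" where
  "spectral2 H \<equiv> spectral_measure H \<Otimes>\<^sub>M spectral_measure H"

text \<open>
  Up to constant factors, a common majorant of the transforms of all step tensors, square integrable
  for the product of the spectral measures.
\<close>

definition spectral_majorant :: "real \<times> real \<Rightarrow> real" where
  "spectral_majorant p = min 1 \<bar>fst p\<bar> * min 1 \<bar>snd p\<bar>"

lemma sets_spectral2 [simp, measurable_cong]: "sets (spectral2 H) = sets borel"
  by (simp add: borel_prod[symmetric] cong: sets_pair_measure_cong)

lemma space_spectral2 [simp]: "space (spectral2 H) = UNIV"
  by (simp add: space_pair_measure)

lemma hartley_step_Nil [simp]: "hartley_step [] = (\<lambda>p. 0)"
  by (simp add: hartley_step_def)

lemma hartley_step_Cons [simp]: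
  "hartley_step ((k, I, J) # xs) = 
    (\<lambda>p. k * (hartley_incr I (fst p) * hartley_incr J (snd p)) + hartley_step xs p)"
  by (simp add: hartley_step_def)

lemma measurable_hartley_step [measurable]: "hartley_step xs \<in> borel_measurable borel"
proof (induction xs)
  case (Cons x xs)
  obtain k I J where x: "x = (k, I, J)" by (cases x)
  note [measurable] = Cons.IH[unfolded borel_prod[symmetric]]
  show ?case unfolding x hartley_step_Cons borel_prod[symmetric] by measurable
qed simp

lemma spectral_majorant_nonneg: "0 \<le> spectral_majorant p"
  by (simp add: spectral_majorant_def)

lemma measurable_spectral_majorant [measurable]: "spectral_majorant \<in> borel_measurable borel"
  unfolding spectral_majorant_def borel_prod[symmetric] by measurable

lemma hartley_step_le_spectral_majorant:
  obtains C where "\<And>p. \<bar>hartley_step xs p\<bar> \<le> C * spectral_majorant p"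
proof -
  have "\<exists>C. \<forall>p. \<bar>hartley_step xs p\<bar> \<le> C * spectral_majorant p"
  proof (induction xs)
    case Nil
    show ?case by (intro exI[of _ 0]) simp
  next
    case (Cons x xs)
    obtain k a b c d where x: "x = (k, (a, b), (c, d))" by (metis prod.exhaust)
    from Cons.IH obtain C where C: "\<And>p. \<bar>hartley_step xs p\<bar> \<le> C * spectral_majorant p" by blast
    define D where "D = \<bar>k\<bar> * ((4 + 2 * \<bar>b - a\<bar>) * (4 + 2 * \<bar>d - c\<bar>))"
    have "\<bar>hartley_step (x # xs) p\<bar> \<le> (D + C) * spectral_majorant p" for p
    proof -
      have "\<bar>k * (hartley_incr (a, b) (fst p) * hartley_incr (c, d) (snd p))\<bar>
          \<le> \<bar>k\<bar> * (((4 + 2 * \<bar>b - a\<bar>) * min 1 \<bar>fst p\<bar>) * ((4 + 2 * \<bar>d - c\<bar>) * min 1 \<bar>snd p\<bar>))"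
        unfolding abs_mult by (intro mult_left_mono mult_mono abs_hartley_incr_le) auto
      also have "\<dots> = D * spectral_majorant p" by (simp add: D_def spectral_majorant_def)
      finally show ?thesis using C[of p] unfolding x by (simp add: distrib_right)
    qed
    then show ?case by blast
  qed
  then show ?thesis using that by blast
qed

lemma step_fun_Nil [simp]: "step_fun [] = (\<lambda>p. 0)"
  by (simp add: step_fun_def fun_eq_iff)

lemma step_fun_Cons [simp]: "step_fun ((k, (a, b), (c, d)) # xs) =
    (\<lambda>p. k * (indicator {a..<b} (fst p) * indicator {c..<d} (snd p)) + step_fun xs p)"
  by (simp add: step_fun_def fun_eq_iff)

lemma step_tensors_Nil [simp]: "[] \<in> step_tensors T"
  by (simp add: step_tensors_def)

lemma step_tensors_Cons [simp]: "((k, (a, b), (c, d)) # xs) \<in> step_tensors T \<longleftrightarrow>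
    0 \<le> a \<and> a \<le> b \<and> b \<le> T \<and> 0 \<le> c \<and> c \<le> d \<and> d \<le> T \<and> xs \<in> step_tensors T"
  by (auto simp: step_tensors_def)

lemma step_diff_in_step_tensors:
  "xs \<in> step_tensors T \<Longrightarrow> ys \<in> step_tensors T \<Longrightarrow> step_diff xs ys \<in> step_tensors T"
  by (fastforce simp: step_tensors_def step_diff_def)

lemma hartley_step_diff: "hartley_step (step_diff xs ys) p = hartley_step xs p - hartley_step ys p"
proof -
  have "hartley_step (map (\<lambda>(k, I, J). (- k, I, J)) ys) p = - hartley_step ys p"
    by (induction ys) auto
  then show ?thesis by (simp add: hartley_step_def step_diff_def)
qed

lemma step_fun_diff: "step_fun (step_diff xs ys) p = step_fun xs p - step_fun ys p"
proof -
  have "step_fun (map (\<lambda>(k, I, J). (- k, I, J)) ys) p = - step_fun ys p"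
    by (induction ys) auto
  then show ?thesis by (cases p) (simp add: step_fun_def step_diff_def)
qed

context
  fixes H :: real
  assumes H: "0 < H" "H < 1 / 2"
begin

interpretation pair_sigma_finite "spectral_measure H" "spectral_measure H"
  by (intro pair_sigma_finite.intro sigma_finite_spectral_measure)

lemma integrable_spectral_majorant_square: "integrable (spectral2 H) (\<lambda>p. (spectral_majorant p)\<^sup>2)"
  using integral_fst_mult_snd(1)[OF integrable_spectral_weight[OF H] integrable_spectral_weight[OF H]]
  by (simp add: spectral_majorant_def power_mult_distrib)

lemma integrable_of_spectral_majorant_bounds:
  assumes [measurable]: "f \<in> borel_measurable borel" "g \<in> borel_measurable borel"
    and f: "\<And>p. \<bar>f p\<bar> \<le> C * spectral_majorant p" and g: "\<And>p. \<bar>g p\<bar> \<le> D * spectral_majorant p"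
  shows "integrable (spectral2 H) (\<lambda>p. f p * g p)"
proof (rule Bochner_Integration.integrable_bound[OF integrable_mult_right[OF integrable_spectral_majorant_square, of "C * D"]])
  have "\<bar>f p * g p\<bar> \<le> \<bar>C * D * (spectral_majorant p)\<^sup>2\<bar>" for p
  proof -
    have "\<bar>f p * g p\<bar> \<le> (C * spectral_majorant p) * (D * spectral_majorant p)"
      unfolding abs_mult by (intro mult_mono f g order_trans[OF abs_ge_zero f]) auto
    then show ?thesis by (simp add: power2_eq_square mult_ac)
  qed
  then show "AE p in spectral2 H. norm (f p * g p) \<le> norm (C * D * (spectral_majorant p)\<^sup>2)" by simp
qed measurable

lemma integrable_hartley_step_mult:
  "integrable (spectral2 H) (\<lambda>p. hartley_step xs p * hartley_step ys p)"
proof -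
  obtain C D where "\<And>p. \<bar>hartley_step xs p\<bar> \<le> C * spectral_majorant p" "\<And>p. \<bar>hartley_step ys p\<bar> \<le> D * spectral_majorant p"
    using hartley_step_le_spectral_majorant by metis
  then show ?thesis by (intro integrable_of_spectral_majorant_bounds) auto
qed

lemma integral_hartley_step_mult:
  assumes "xs \<in> step_tensors T" "ys \<in> step_tensors T"
  shows "(\<integral>p. hartley_step xs p * hartley_step ys p \<partial>spectral2 H) = (spectral_const H)\<^sup>2 * step_inner H xs ys"
  using assms(1)
proof (induction xs)
  case Nil
  show ?case by (simp add: step_inner_def)
next
  case (Cons x xs)
  obtain k a b c d where x: "x = (k, (a, b), (c, d))" by (metis prod.exhaust)
  have xs: "xs \<in> step_tensors T" and ineq: "0 \<le> a" "a \<le> b" "0 \<le> c" "c \<le> d"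
    using Cons.prems by (auto simp: x)
  let ?e = "\<lambda>p. hartley_incr (a, b) (fst p) * hartley_incr (c, d) (snd p)"
  let ?s = "\<lambda>ys. \<Sum>(k', I', J') \<leftarrow> ys. k * k' * (interval_inner H (a, b) I' * interval_inner H (c, d) J')"
  have single: "(\<integral>p. k * ?e p * hartley_step ys p \<partial>spectral2 H) = (spectral_const H)\<^sup>2 * ?s ys
      \<and> integrable (spectral2 H) (\<lambda>p. k * ?e p * hartley_step ys p)"
    using assms(2)
  proof (induction ys)
    case Nil
    show ?case by simp
  next
    case (Cons y ys)
    obtain k' a' b' c' d' where y: "y = (k', (a', b'), (c', d'))" by (metis prod.exhaust)
    have ys: "ys \<in> step_tensors T" and ineq': "0 \<le> a'" "a' \<le> b'" "0 \<le> c'" "c' \<le> d'"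
      using Cons.prems by (auto simp: y)
    let ?p1 = "\<lambda>\<xi>. hartley_incr (a, b) \<xi> * hartley_incr (a', b') \<xi>"
    let ?p2 = "\<lambda>\<xi>. hartley_incr (c, d) \<xi> * hartley_incr (c', d') \<xi>"
    have i1: "integrable (spectral_measure H) ?p1" "integral\<^sup>L (spectral_measure H) ?p1 = spectral_const H * interval_inner H (a, b) (a', b')"
      using ineq ineq' by (intro integral_hartley_incr[OF H]; simp)+
    have i2: "integrable (spectral_measure H) ?p2" "integral\<^sup>L (spectral_measure H) ?p2 = spectral_const H * interval_inner H (c, d) (c', d')"
      using ineq ineq' by (intro integral_hartley_incr[OF H]; simp)+
    have eq: "k * ?e p * hartley_step (y # ys) p =
        k * k' * (?p1 (fst p) * ?p2 (snd p)) + k * ?e p * hartley_step ys p" for p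
      by (simp add: y algebra_simps)
    have int: "integrable (spectral2 H) (\<lambda>p. k * k' * (?p1 (fst p) * ?p2 (snd p)))"
      by (intro integrable_mult_right integral_fst_mult_snd i1 i2)
    have val: "(\<integral>p. k * k' * (?p1 (fst p) * ?p2 (snd p)) \<partial>spectral2 H) =
        (spectral_const H)\<^sup>2 * (k * k' * (interval_inner H (a, b) (a', b') * interval_inner H (c, d) (c', d')))"
      by (subst integral_mult_right_zero, subst integral_fst_mult_snd(2)[OF i1(1) i2(1)])
         (simp add: i1 i2 power2_eq_square)
    show ?case
      unfolding eq using int val Cons.IH[OF ys]
      by (simp add: y algebra_simps)
  qed
  have eq: "hartley_step (x # xs) p * hartley_step ys p =
      k * ?e p * hartley_step ys p + hartley_step xs p * hartley_step ys p" for p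
    by (simp add: x algebra_simps)
  have "(\<integral>p. hartley_step (x # xs) p * hartley_step ys p \<partial>spectral2 H) =
      (spectral_const H)\<^sup>2 * ?s ys + (spectral_const H)\<^sup>2 * step_inner H xs ys"
    unfolding eq using single Cons.IH[OF xs] integrable_hartley_step_mult[of xs ys]
    by (subst Bochner_Integration.integral_add) auto
  also have "\<dots> = (spectral_const H)\<^sup>2 * step_inner H (x # xs) ys"
    by (simp add: x step_inner_def algebra_simps)
  finally show ?case .
qed

lemma step_inner_nonneg:
  assumes "xs \<in> step_tensors T"
  shows "0 \<le> step_inner H xs xs"
proof -
  have "0 \<le> (\<integral>p. hartley_step xs p * hartley_step xs p \<partial>spectral2 H)"
    by (intro Bochner_Integration.integral_nonneg) simp
  then show ?thesis
    using spectral_const_pos[OF H]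
    by (simp add: integral_hartley_step_mult[OF assms assms] zero_le_mult_iff)
qed

lemma step_norm_square:
  "xs \<in> step_tensors T \<Longrightarrow> (step_norm H xs)\<^sup>2 = step_inner H xs xs"
  using step_inner_nonneg by (simp add: step_norm_def)

lemma step_norm_nonneg: "xs \<in> step_tensors T \<Longrightarrow> 0 \<le> step_norm H xs"
  using step_inner_nonneg by (simp add: step_norm_def)

lemma nn_integral_hartley_step_square:
  assumes "xs \<in> step_tensors T"
  shows "(\<integral>\<^sup>+p. ennreal ((hartley_step xs p)\<^sup>2) \<partial>spectral2 H) = ennreal ((spectral_const H * step_norm H xs)\<^sup>2)"
  using integrable_hartley_step_mult[of xs xs] integral_hartley_step_mult[OF assms assms]
  by (subst nn_integral_eq_integral)
     (auto simp: power_mult_distrib step_norm_square[OF assms] power2_eq_square[symmetric])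

text \<open>
  The embedding makes the form positive semidefinite, which is not visible from its definition by
  covariances; the usual discriminant argument applies.
\<close>

lemma step_inner_Cauchy_Schwarz:
  assumes xs: "xs \<in> step_tensors T" and ys: "ys \<in> step_tensors T"
  shows "\<bar>step_inner H xs ys\<bar> \<le> step_norm H xs * step_norm H ys"
proof -
  let ?c = "(spectral_const H)\<^sup>2" and ?A = "step_inner H xs xs" and ?B = "step_inner H xs ys"
    and ?C = "step_inner H ys ys"
  have c: "?c > 0" using spectral_const_pos[OF H] by simp
  have quad: "0 \<le> ?A + 2 * r * ?B + r\<^sup>2 * ?C" for r
  proof -
    have "0 \<le> (\<integral>p. (hartley_step xs p + r * hartley_step ys p)\<^sup>2 \<partial>spectral2 H)"
      by (intro Bochner_Integration.integral_nonneg) simp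
    also have "\<dots> = (\<integral>p. hartley_step xs p * hartley_step xs p + 2 * r * (hartley_step xs p * hartley_step ys p)
        + r\<^sup>2 * (hartley_step ys p * hartley_step ys p) \<partial>spectral2 H)"
      by (intro Bochner_Integration.integral_cong) (auto simp: power2_eq_square algebra_simps)
    also have "\<dots> = ?c * ?A + 2 * r * (?c * ?B) + r\<^sup>2 * (?c * ?C)"
      using integrable_hartley_step_mult
      by (simp add: integral_hartley_step_mult[OF xs xs] integral_hartley_step_mult[OF xs ys]
          integral_hartley_step_mult[OF ys ys])
    also have "\<dots> = ?c * (?A + 2 * r * ?B + r\<^sup>2 * ?C)" by (simp add: algebra_simps)
    finally show ?thesis using c by (simp add: zero_le_mult_iff)
  qed
  have "?B\<^sup>2 \<le> ?A * ?C"
  proof (cases "?C = 0")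
    case True
    have "?B = 0"
    proof (rule ccontr)
      assume "?B \<noteq> 0"
      \<comment> \<open>an argument at which the then affine form takes the value \<open>-1\<close>\<close>
      then obtain r where "2 * r * ?B = - (?A + 1)"
        by (metis mult.assoc mult.commute nonzero_mult_div_cancel_left times_divide_eq_right zero_neq_numeral)
      then show False using quad[of r] True by simp
    qed
    then show ?thesis using True by simp
  next
    case False
    then have "?C > 0" using step_inner_nonneg[OF ys] by simp
    then show ?thesis using quad[of "- ?B / ?C"]
      by (simp add: field_simps power2_eq_square)
  qed
  then have "sqrt (?B\<^sup>2) \<le> sqrt (?A * ?C)" by (rule real_sqrt_le_mono)
  then show ?thesis by (simp add: step_norm_def real_sqrt_mult)
qed

lemma step_inner_diff_left:
  "step_inner H (step_diff xs ys) zs = step_inner H xs zs - step_inner H ys zs"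
proof -
  have "step_inner H (map (\<lambda>(k, I, J). (- k, I, J)) ys) zs = - step_inner H ys zs"
    by (induction ys) (auto simp: step_inner_def uminus_sum_list_map o_def case_prod_unfold)
  then show ?thesis by (simp add: step_inner_def step_diff_def)
qed

text \<open>
  Commutativity is read off from the embedding rather than from a permutation of the two sums.
\<close>

lemma step_inner_commute: "xs \<in> step_tensors T \<Longrightarrow> ys \<in> step_tensors T \<Longrightarrow> step_inner H xs ys = step_inner H ys xs"
  using integral_hartley_step_mult[of xs T ys] integral_hartley_step_mult[of ys T xs] spectral_const_pos[OF H]
  by (simp add: mult.commute[of "hartley_step xs _"])

lemma step_norm_le_add_diff:
  assumes xs: "xs \<in> step_tensors T" and ys: "ys \<in> step_tensors T"
  shows "step_norm H xs \<le> step_norm H (step_diff xs ys) + step_norm H ys"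
proof (cases "step_norm H xs = 0")
  case True
  then show ?thesis
    using step_norm_nonneg[OF ys] step_norm_nonneg[OF step_diff_in_step_tensors[OF xs ys]] by simp
next
  case False
  then have pos: "step_norm H xs > 0" using step_norm_nonneg[OF xs] by simp
  have "step_norm H xs * step_norm H xs = step_inner H (step_diff xs ys) xs + step_inner H ys xs"
    using step_norm_square[OF xs] by (simp add: step_inner_diff_left power2_eq_square)
  also have "\<dots> \<le> step_norm H (step_diff xs ys) * step_norm H xs + step_norm H ys * step_norm H xs"
    using step_inner_Cauchy_Schwarz[OF step_diff_in_step_tensors[OF xs ys] xs]
      step_inner_Cauchy_Schwarz[OF ys xs] by linarith
  finally show ?thesis using pos by (simp flip: distrib_right)
qed

lemma step_inner_perturb:
  assumes "xs \<in> step_tensors T" "xs' \<in> step_tensors T" "ys \<in> step_tensors T" "ys' \<in> step_tensors T"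
  shows "\<bar>step_inner H xs ys - step_inner H xs' ys'\<bar> \<le>
    step_norm H (step_diff xs xs') * step_norm H ys + step_norm H (step_diff ys ys') * step_norm H xs'"
proof -
  note diffs = step_diff_in_step_tensors[OF assms(1,2)] step_diff_in_step_tensors[OF assms(3,4)]
  have "step_inner H xs ys - step_inner H xs' ys' =
      step_inner H (step_diff xs xs') ys + step_inner H (step_diff ys ys') xs'"
    using step_inner_commute[OF assms(2,3)] step_inner_commute[OF assms(2,4)]
    by (simp add: step_inner_diff_left)
  then show ?thesis
    using step_inner_Cauchy_Schwarz[OF diffs(1) assms(3)] step_inner_Cauchy_Schwarz[OF diffs(2) assms(2)]
    by linarith
qed

end

section \<open>Uniqueness of the element represented by a function\<close>

lemma hartley_incr_eq_integral:
  assumes "a \<le> b"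
  shows "integrable lborel (\<lambda>t. indicator {a..<b} t * cas (- (t * \<xi>)))"
    and "\<xi> * (\<integral>t. indicator {a..<b} t * cas (- (t * \<xi>)) \<partial>lborel) = hartley_incr (a, b) \<xi>"
proof -
  have "AE t in lborel. indicator {a..<b} t * cas (- (t * \<xi>)) = cas (- (t * \<xi>)) * indicator {a..b} t"
    using AE_lborel_singleton[of b] by eventually_elim (auto simp: indicator_def)
  note ae = this
  have [measurable]: "(\<lambda>t. indicator {a..<b} t * cas (- (t * \<xi>))) \<in> borel_measurable lborel"
    "(\<lambda>t. cas (- (t * \<xi>)) * indicator {a..b} t) \<in> borel_measurable lborel" by measurable
  have "isCont (\<lambda>t. cas (- (t * \<xi>))) t" for t
    unfolding cas_def by (intro continuous_intros)
  then have "integrable lborel (\<lambda>t. cas (- (t * \<xi>)) * indicator {a..b} t)"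
    by (intro borel_integrable_atLeastAtMost) auto
  then show int: "integrable lborel (\<lambda>t. indicator {a..<b} t * cas (- (t * \<xi>)))"
    by (subst integrable_cong_AE[OF _ _ ae]) auto
  have "(\<integral>t. \<xi> * cas (- (t * \<xi>)) * indicator {a..b} t \<partial>lborel) = cas (b * \<xi>) - cas (a * \<xi>)"
  proof (rule integral_FTC_Icc_real[OF assms])
    fix t
    show "((\<lambda>t. cas (t * \<xi>)) has_real_derivative \<xi> * cas (- (t * \<xi>))) (at t)"
      unfolding cas_def by (auto intro!: derivative_eq_intros simp: algebra_simps)
    show "isCont (\<lambda>t. \<xi> * cas (- (t * \<xi>))) t"
      unfolding cas_def by (intro continuous_intros)
  qed
  also have "(\<integral>t. \<xi> * cas (- (t * \<xi>)) * indicator {a..b} t \<partial>lborel)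
      = \<xi> * (\<integral>t. cas (- (t * \<xi>)) * indicator {a..b} t \<partial>lborel)"
    by (simp add: mult.assoc)
  also have "(\<integral>t. cas (- (t * \<xi>)) * indicator {a..b} t \<partial>lborel)
      = (\<integral>t. indicator {a..<b} t * cas (- (t * \<xi>)) \<partial>lborel)"
    by (rule integral_cong_AE) (use ae in \<open>auto elim: eventually_mono\<close>)
  finally show "\<xi> * (\<integral>t. indicator {a..<b} t * cas (- (t * \<xi>)) \<partial>lborel) = hartley_incr (a, b) \<xi>"
    by (simp add: hartley_incr_def)
qed

lemma measurable_step_fun [measurable]: "step_fun xs \<in> borel_measurable borel"
proof (induction xs)
  case (Cons x xs)
  obtain k a b c d where x: "x = (k, (a, b), (c, d))" by (metis prod.exhaust)
  note [measurable] = Cons.IH[unfolded borel_prod[symmetric]]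
  show ?case unfolding x step_fun_Cons borel_prod[symmetric] by measurable
qed simp

lemma step_fun_outside:
  assumes "xs \<in> step_tensors T" "p \<notin> {0..T} \<times> {0..T}"
  shows "step_fun xs p = 0"
  using assms(1)
proof (induction xs)
  case (Cons x xs)
  obtain k a b c d where x: "x = (k, (a, b), (c, d))" by (metis prod.exhaust)
  show ?case using Cons assms(2) unfolding x by (cases p) (auto simp: indicator_def)
qed simp

definition hartley_kernel :: "real \<times> real \<Rightarrow> real \<times> real \<Rightarrow> real" where
  "hartley_kernel p q = cas (- (fst q * fst p)) * cas (- (snd q * snd p))"

lemma abs_hartley_kernel_le: "\<bar>hartley_kernel p q\<bar> \<le> 4"
  unfolding hartley_kernel_def abs_mult
  using mult_mono[OF abs_cas_le[of "- (fst q * fst p)"] abs_cas_le[of "- (snd q * snd p)"]] by simp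

lemma hartley_step_eq_integral:
  assumes "xs \<in> step_tensors T"
  shows "integrable lborel (\<lambda>q. step_fun xs q * hartley_kernel p q) \<and>
    hartley_step xs p = fst p * snd p * (\<integral>q. step_fun xs q * hartley_kernel p q \<partial>lborel)"
  using assms
proof (induction xs)
  case (Cons x xs)
  obtain k a b c d where x: "x = (k, (a, b), (c, d))" by (metis prod.exhaust)
  have ab: "a \<le> b" and cd: "c \<le> d" and xs: "xs \<in> step_tensors T"
    using Cons.prems by (auto simp: x)
  let ?f = "\<lambda>t. indicator {a..<b} t * cas (- (t * fst p))"
  let ?g = "\<lambda>t. indicator {c..<d} t * cas (- (t * snd p))"
  have eq: "step_fun (x # xs) q * hartley_kernel p q =
      k * (?f (fst q) * ?g (snd q)) + step_fun xs q * hartley_kernel p q" for q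
    by (simp add: x hartley_kernel_def algebra_simps)
  have int: "integrable lborel (\<lambda>q. k * (?f (fst q) * ?g (snd q)))"
    using lborel_pair.integral_fst_mult_snd(1)[OF hartley_incr_eq_integral(1)[OF ab] hartley_incr_eq_integral(1)[OF cd]]
    unfolding lborel_prod by (rule integrable_mult_right)
  have "fst p * snd p * (\<integral>q. k * (?f (fst q) * ?g (snd q)) \<partial>lborel) =
      k * ((fst p * (\<integral>t. ?f t \<partial>lborel)) * (snd p * (\<integral>t. ?g t \<partial>lborel)))"
    using lborel_pair.integral_fst_mult_snd(2)[OF hartley_incr_eq_integral(1)[OF ab] hartley_incr_eq_integral(1)[OF cd]]
    unfolding lborel_prod by simp
  also have "\<dots> = k * (hartley_incr (a, b) (fst p) * hartley_incr (c, d) (snd p))"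
    unfolding hartley_incr_eq_integral(2)[OF ab] hartley_incr_eq_integral(2)[OF cd] ..
  finally show ?case
    unfolding eq using Cons.IH[OF xs] int by (auto simp: x distrib_left)
qed simp

lemma square_sets_lebesgue [simp, measurable]: "{0..T::real} \<times> {0..T::real} \<in> sets lebesgue"
proof -
  have "{0..T} \<times> {0..T} = cbox (0, 0) (T, T::real)" by (simp add: cbox_Pair_eq)
  then show ?thesis by (metis lmeasurable_cbox fmeasurableD)
qed

lemma nn_integral_lebesgue_on_eq_lborel:
  assumes "\<And>p. p \<notin> {0..T} \<times> {0..T} \<Longrightarrow> g p = 0"
  shows "(\<integral>\<^sup>+p. g p \<partial>lebesgue_on ({0..T::real} \<times> {0..T::real})) = (\<integral>\<^sup>+p. g p \<partial>lborel)"
proof -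
  have "(\<integral>\<^sup>+p. g p \<partial>lebesgue_on ({0..T} \<times> {0..T})) = (\<integral>\<^sup>+p. g p * indicator ({0..T} \<times> {0..T}) p \<partial>lebesgue)"
    by (subst nn_integral_restrict_space) auto
  also have "\<dots> = (\<integral>\<^sup>+p. g p \<partial>lebesgue)"
    using assms by (intro nn_integral_cong) (auto simp: indicator_def)
  finally show ?thesis by (simp add: nn_integral_completion)
qed

lemma emeasure_lebesgue_on_square:
  assumes "T \<ge> 0"
  shows "(\<integral>\<^sup>+p. 1 \<partial>lebesgue_on ({0..T::real} \<times> {0..T::real})) = ennreal (T\<^sup>2)"
proof -
  have "(\<integral>\<^sup>+p. 1 \<partial>lebesgue_on ({0..T} \<times> {0..T})) = emeasure lebesgue ({0..T} \<times> {0..T})"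
    by (simp add: emeasure_restrict_space)
  also have "\<dots> = emeasure (lborel \<Otimes>\<^sub>M lborel) ({0..T} \<times> {0..T})"
    by (simp add: lborel_prod borel_prod[symmetric])
  also have "\<dots> = ennreal (T\<^sup>2)"
    using assms by (subst lborel.emeasure_pair_measure_Times) (auto simp: power2_eq_square ennreal_mult)
  finally show ?thesis .
qed

lemma borel_measurable_lebesgue_on_borel [measurable (raw)]:
  "g \<in> borel_measurable borel \<Longrightarrow> g \<in> borel_measurable (lebesgue_on S)"
  by (simp add: measurable_restrict_space1 measurable_completion)

text \<open>
  At a fixed frequency the transform is, up to the factor \<open>\<xi> \<eta>\<close>, the integral of the
  function against a bounded kernel, so it is controlled by the \<open>L\<^sup>1\<close> norm and, on the bounded
  square, by the \<open>L\<^sup>2\<close> norm.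
\<close>

lemma hartley_step_le_L2:
  assumes T: "T \<ge> 0" and xs: "xs \<in> step_tensors T"
  shows "ennreal ((hartley_step xs p)\<^sup>2) \<le> ennreal ((4 * T * fst p * snd p)\<^sup>2) *
    (\<integral>\<^sup>+q. ennreal ((step_fun xs q)\<^sup>2) \<partial>lebesgue_on ({0..T} \<times> {0..T}))"
proof -
  let ?L = "lebesgue_on ({0..T} \<times> {0..T})"
  have "\<bar>hartley_step xs p\<bar> \<le> \<bar>fst p * snd p\<bar> * (\<integral>q. \<bar>step_fun xs q * hartley_kernel p q\<bar> \<partial>lborel)"
    using hartley_step_eq_integral[OF xs, of p] integral_abs_bound[of lborel "\<lambda>q. step_fun xs q * hartley_kernel p q"]
    by (auto simp: abs_mult[of "fst p * snd p"] intro!: mult_left_mono)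
  then have le1: "ennreal \<bar>hartley_step xs p\<bar> \<le>
      ennreal \<bar>fst p * snd p\<bar> * ennreal (\<integral>q. \<bar>step_fun xs q * hartley_kernel p q\<bar> \<partial>lborel)"
    by (simp add: ennreal_mult'[symmetric] ennreal_leI)
  have "ennreal (\<integral>q. \<bar>step_fun xs q * hartley_kernel p q\<bar> \<partial>lborel) =
      (\<integral>\<^sup>+q. ennreal \<bar>step_fun xs q * hartley_kernel p q\<bar> \<partial>lborel)"
    using hartley_step_eq_integral[OF xs, of p] by (subst nn_integral_eq_integral) auto
  also have "\<dots> \<le> (\<integral>\<^sup>+q. 4 * ennreal \<bar>step_fun xs q\<bar> \<partial>lborel)"
  proof (rule nn_integral_mono)
    fix q
    have "\<bar>step_fun xs q * hartley_kernel p q\<bar> \<le> 4 * \<bar>step_fun xs q\<bar>"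
      using mult_right_mono[OF abs_hartley_kernel_le[of p q] abs_ge_zero[of "step_fun xs q"]]
      by (simp add: abs_mult mult.commute)
    then have "ennreal \<bar>step_fun xs q * hartley_kernel p q\<bar> \<le> ennreal (4 * \<bar>step_fun xs q\<bar>)"
      by (rule ennreal_leI)
    then show "ennreal \<bar>step_fun xs q * hartley_kernel p q\<bar> \<le> 4 * ennreal \<bar>step_fun xs q\<bar>"
      by (simp add: ennreal_mult')
  qed
  also have "\<dots> = 4 * (\<integral>\<^sup>+q. ennreal \<bar>step_fun xs q\<bar> \<partial>?L)"
    by (subst nn_integral_cmult, simp, subst nn_integral_lebesgue_on_eq_lborel)
       (simp_all add: step_fun_outside[OF xs])
  finally have le2: "ennreal (\<integral>q. \<bar>step_fun xs q * hartley_kernel p q\<bar> \<partial>lborel)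
      \<le> 4 * (\<integral>\<^sup>+q. ennreal \<bar>step_fun xs q\<bar> \<partial>?L)" .
  have le: "ennreal \<bar>hartley_step xs p\<bar> \<le>
      ennreal (4 * \<bar>fst p * snd p\<bar>) * (\<integral>\<^sup>+q. ennreal \<bar>step_fun xs q\<bar> \<partial>?L)"
    using order_trans[OF le1 mult_left_mono[OF le2]] by (simp add: ennreal_mult' mult_ac)
  have CS: "(\<integral>\<^sup>+q. ennreal \<bar>step_fun xs q\<bar> \<partial>?L)\<^sup>2 \<le> (\<integral>\<^sup>+q. ennreal ((step_fun xs q)\<^sup>2) \<partial>?L) * ennreal (T\<^sup>2)"
    using Cauchy_Schwarz_nn_integral[of "\<lambda>q. ennreal \<bar>step_fun xs q\<bar>" ?L "\<lambda>q. 1"]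
      emeasure_lebesgue_on_square[OF T]
    by (simp add: ennreal_power)
  have "ennreal ((hartley_step xs p)\<^sup>2) = (ennreal \<bar>hartley_step xs p\<bar>)\<^sup>2"
    by (simp add: ennreal_power)
  also have "\<dots> \<le> (ennreal (4 * \<bar>fst p * snd p\<bar>) * (\<integral>\<^sup>+q. ennreal \<bar>step_fun xs q\<bar> \<partial>?L))\<^sup>2"
    using le by (intro power_mono) auto
  also have "\<dots> \<le> ennreal ((4 * \<bar>fst p * snd p\<bar>)\<^sup>2) * ((\<integral>\<^sup>+q. ennreal ((step_fun xs q)\<^sup>2) \<partial>?L) * ennreal (T\<^sup>2))"
    using CS by (simp add: power_mult_distrib ennreal_power mult_left_mono)
  also have "\<dots> = ennreal ((4 * T * fst p * snd p)\<^sup>2) * (\<integral>\<^sup>+q. ennreal ((step_fun xs q)\<^sup>2) \<partial>?L)"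
    by (simp add: power_mult_distrib ennreal_mult' mult_ac)
  finally show ?thesis .
qed

lemma square_diff_le: "((a::real) - b)\<^sup>2 \<le> 2 * (c - a)\<^sup>2 + 2 * (c - b)\<^sup>2"
  using zero_le_power2[of "(c - a) + (c - b)"] by (simp add: power2_eq_square algebra_simps)

lemma hartley_step_diff_le_L2:
  assumes T: "T \<ge> 0" and xs: "xs \<in> step_tensors T" and ys: "ys \<in> step_tensors T"
    and [measurable]: "f \<in> borel_measurable (lebesgue_on ({0..T} \<times> {0..T}))"
  shows "ennreal ((hartley_step xs p - hartley_step ys p)\<^sup>2) \<le> ennreal ((4 * T * fst p * snd p)\<^sup>2) *
    (2 * (\<integral>\<^sup>+q. ennreal ((f q - step_fun xs q)\<^sup>2) \<partial>lebesgue_on ({0..T} \<times> {0..T}))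
      + 2 * (\<integral>\<^sup>+q. ennreal ((f q - step_fun ys q)\<^sup>2) \<partial>lebesgue_on ({0..T} \<times> {0..T})))"
proof -
  let ?L = "lebesgue_on ({0..T} \<times> {0..T})"
  have "(\<integral>\<^sup>+q. ennreal ((step_fun (step_diff xs ys) q)\<^sup>2) \<partial>?L) \<le>
      (\<integral>\<^sup>+q. 2 * ennreal ((f q - step_fun xs q)\<^sup>2) + 2 * ennreal ((f q - step_fun ys q)\<^sup>2) \<partial>?L)"
  proof (rule nn_integral_mono)
    fix q
    have "ennreal ((step_fun xs q - step_fun ys q)\<^sup>2) \<le> ennreal (2 * (f q - step_fun xs q)\<^sup>2 + 2 * (f q - step_fun ys q)\<^sup>2)"
      by (intro ennreal_leI square_diff_le)
    then show "ennreal ((step_fun (step_diff xs ys) q)\<^sup>2) \<le>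
        2 * ennreal ((f q - step_fun xs q)\<^sup>2) + 2 * ennreal ((f q - step_fun ys q)\<^sup>2)"
      by (simp add: step_fun_diff ennreal_mult')
  qed
  also have "\<dots> = 2 * (\<integral>\<^sup>+q. ennreal ((f q - step_fun xs q)\<^sup>2) \<partial>?L) + 2 * (\<integral>\<^sup>+q. ennreal ((f q - step_fun ys q)\<^sup>2) \<partial>?L)"
    by (subst nn_integral_add) (auto simp: nn_integral_cmult)
  finally have le: "(\<integral>\<^sup>+q. ennreal ((step_fun (step_diff xs ys) q)\<^sup>2) \<partial>?L) \<le>
      2 * (\<integral>\<^sup>+q. ennreal ((f q - step_fun xs q)\<^sup>2) \<partial>?L) + 2 * (\<integral>\<^sup>+q. ennreal ((f q - step_fun ys q)\<^sup>2) \<partial>?L)" .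
  show ?thesis
    unfolding hartley_step_diff[symmetric]
    by (rule order_trans[OF hartley_step_le_L2[OF T step_diff_in_step_tensors[OF xs ys]] mult_left_mono[OF le]]) simp
qed

lemma tendsto_0_of_square_ennreal:
  fixes u :: "'a \<Rightarrow> real"
  assumes "\<And>x. ennreal ((u x)\<^sup>2) \<le> v x" and "(v \<longlongrightarrow> 0) F"
  shows "(u \<longlongrightarrow> 0) F"
proof -
  have "((\<lambda>x. ennreal ((u x)\<^sup>2)) \<longlongrightarrow> ennreal 0) F"
    unfolding ennreal_0
    by (rule tendsto_sandwich[of "\<lambda>_. 0", OF _ _ tendsto_const assms(2)]) (simp_all add: assms(1))
  then have "((\<lambda>x. (u x)\<^sup>2) \<longlongrightarrow> 0) F"
    by (subst (asm) tendsto_ennreal_iff) auto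
  then have "((\<lambda>x. sqrt ((u x)\<^sup>2)) \<longlongrightarrow> sqrt 0) F" by (rule tendsto_real_sqrt)
  then show ?thesis by (simp add: tendsto_rabs_zero_iff)
qed

lemma represents_hartley_diff_tendsto_0:
  assumes T: "T \<ge> 0" and X: "represents H T X f" and Y: "represents H T Y f"
  shows "(\<lambda>n. hartley_step (X n) p - hartley_step (Y n) p) \<longlonglongrightarrow> 0"
proof (rule tendsto_0_of_square_ennreal[OF hartley_step_diff_le_L2[OF T, of _ _ f]])
  let ?d = "\<lambda>X n. \<integral>\<^sup>+q. ennreal ((f q - step_fun (X n) q)\<^sup>2) \<partial>lebesgue_on ({0..T} \<times> {0..T})"
  have "?d X \<longlonglongrightarrow> 0" "?d Y \<longlonglongrightarrow> 0" using X Y by (auto simp: represents_def)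
  then have "(\<lambda>n. ennreal ((4 * T * fst p * snd p)\<^sup>2) * (2 * ?d X n + 2 * ?d Y n)) \<longlonglongrightarrow>
      ennreal ((4 * T * fst p * snd p)\<^sup>2) * (2 * 0 + 2 * 0)"
    by (intro ennreal_tendsto_cmult tendsto_add) auto
  then show "(\<lambda>n. ennreal ((4 * T * fst p * snd p)\<^sup>2) * (2 * ?d X n + 2 * ?d Y n)) \<longlonglongrightarrow> 0" by simp
qed (use X Y in \<open>auto simp: represents_def\<close>)

text \<open>
  Step functions built from half-open subintervals of \<open>[0,T)\<close> vanish on the upper and the right edge
  of the square, so approximation can only be expected off these edges.
\<close>

lemma AE_lebesgue_on_square_open:
  "AE p in lebesgue_on ({0..T::real} \<times> {0..T::real}). p \<in> {0..<T} \<times> {0..<T}"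
proof -
  have "negligible {p :: real \<times> real. p \<bullet> (1, 0) = T}" "negligible {p :: real \<times> real. p \<bullet> (0, 1) = T}"
    by (intro negligible_standard_hyperplane; simp add: Basis_prod_def)+
  then have "AE p in lebesgue. p \<bullet> (1 :: real, 0 :: real) \<noteq> T" "AE p in lebesgue. p \<bullet> (0 :: real, 1 :: real) \<noteq> T"
    by (auto simp: negligible_iff_null_sets dest!: AE_not_in)
  then have "AE p in lebesgue. p \<in> {0..T} \<times> {0..T} \<longrightarrow> p \<in> {0..<T} \<times> {0..<T}"
    by (elim AE_mp) (auto intro!: AE_I2 simp: inner_prod_def)
  then show ?thesis by (subst AE_restrict_space_iff) auto
qed

context
  fixes H :: real
  assumes H: "0 < H" "H < 1 / 2"
begin

lemma nn_integral_hartley_diff_square: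
  assumes "xs \<in> step_tensors T" "ys \<in> step_tensors T"
  shows "(\<integral>\<^sup>+p. ennreal ((hartley_step xs p - hartley_step ys p)\<^sup>2) \<partial>spectral2 H) =
     ennreal ((spectral_const H * step_norm H (step_diff xs ys))\<^sup>2)"
  using nn_integral_hartley_step_square[OF H step_diff_in_step_tensors[OF assms]]
  by (simp add: hartley_step_diff)

text \<open>
  Closability of the embedding. Let \<open>Z n\<close> be the difference of the two transforms. It tends to
  zero pointwise, and it is Cauchy in \<open>L\<^sup>2\<close> of the spectral measure; since \<open>Z n\<close> is the pointwise limit
  of \<open>Z n - Z m\<close> as \<open>m\<close> grows, Fatou's lemma bounds its norm by the Cauchy modulus.
\<close>

lemma represents_unique:
  assumes T: "T \<ge> 0" and X: "represents H T X f" and Y: "represents H T Y f"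
  shows "(\<lambda>n. step_norm H (step_diff (X n) (Y n))) \<longlonglongrightarrow> 0"
proof (rule LIMSEQ_I)
  fix r :: real assume r: "0 < r"
  \<comment> \<open>two Cauchy moduli \<open>e\<close> combine to \<open>2 e\<close> through \<open>(u - v)\<^sup>2 \<le> 2 u\<^sup>2 + 2 v\<^sup>2\<close>, and \<open>2 e < r\<close>\<close>
  define e where "e = r / 4"
  have e: "e > 0" using r by (simp add: e_def)
  let ?c = "spectral_const H"
  have c: "?c > 0" by (rule spectral_const_pos[OF H])
  have XT: "X n \<in> step_tensors T" and YT: "Y n \<in> step_tensors T" for n
    using X Y by (auto simp: represents_def)
  obtain N1 where N1: "\<And>m n. m \<ge> N1 \<Longrightarrow> n \<ge> N1 \<Longrightarrow> step_norm H (step_diff (X m) (X n)) < e"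
    using X e unfolding represents_def by metis
  obtain N2 where N2: "\<And>m n. m \<ge> N2 \<Longrightarrow> n \<ge> N2 \<Longrightarrow> step_norm H (step_diff (Y m) (Y n)) < e"
    using Y e unfolding represents_def by metis
  define Z where "Z n p = hartley_step (X n) p - hartley_step (Y n) p" for n p
  have [measurable]: "Z n \<in> borel_measurable borel" for n unfolding Z_def by measurable
  have Z0: "(\<lambda>n. Z n p) \<longlonglongrightarrow> 0" for p
    unfolding Z_def by (rule represents_hartley_diff_tendsto_0[OF T X Y])
  have Cauchy: "(\<integral>\<^sup>+p. ennreal ((Z n p - Z m p)\<^sup>2) \<partial>spectral2 H) \<le> ennreal ((2 * ?c * e)\<^sup>2)"
    if "m \<ge> max N1 N2" "n \<ge> max N1 N2" for m n
  proof -
    have "(\<integral>\<^sup>+p. ennreal ((Z n p - Z m p)\<^sup>2) \<partial>spectral2 H) \<le>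
        (\<integral>\<^sup>+p. 2 * ennreal ((hartley_step (X n) p - hartley_step (X m) p)\<^sup>2)
            + 2 * ennreal ((hartley_step (Y n) p - hartley_step (Y m) p)\<^sup>2) \<partial>spectral2 H)"
    proof (rule nn_integral_mono)
      fix p
      have "(Z n p - Z m p)\<^sup>2 \<le> 2 * (hartley_step (X n) p - hartley_step (X m) p)\<^sup>2
            + 2 * (hartley_step (Y n) p - hartley_step (Y m) p)\<^sup>2"
      proof -
        have "Z n p - Z m p = (hartley_step (X n) p - hartley_step (X m) p) - (hartley_step (Y n) p - hartley_step (Y m) p)"
          by (simp add: Z_def)
        moreover have "(u - v)\<^sup>2 \<le> 2 * u\<^sup>2 + 2 * v\<^sup>2" for u v :: real
          using square_diff_le[of u v 0] by simp
        ultimately show ?thesis by simp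
      qed
      then have "ennreal ((Z n p - Z m p)\<^sup>2) \<le> ennreal (2 * (hartley_step (X n) p - hartley_step (X m) p)\<^sup>2
            + 2 * (hartley_step (Y n) p - hartley_step (Y m) p)\<^sup>2)" by (rule ennreal_leI)
      then show "ennreal ((Z n p - Z m p)\<^sup>2) \<le> 2 * ennreal ((hartley_step (X n) p - hartley_step (X m) p)\<^sup>2)
            + 2 * ennreal ((hartley_step (Y n) p - hartley_step (Y m) p)\<^sup>2)"
        by (simp add: ennreal_mult')
    qed
    also have "\<dots> = 2 * ennreal ((?c * step_norm H (step_diff (X n) (X m)))\<^sup>2)
        + 2 * ennreal ((?c * step_norm H (step_diff (Y n) (Y m)))\<^sup>2)"
      by (subst nn_integral_add) (auto simp: nn_integral_cmult nn_integral_hartley_diff_square[OF XT XT] nn_integral_hartley_diff_square[OF YT YT])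
    also have "\<dots> = ennreal (2 * (?c * step_norm H (step_diff (X n) (X m)))\<^sup>2
        + 2 * (?c * step_norm H (step_diff (Y n) (Y m)))\<^sup>2)"
      by (simp add: ennreal_mult')
    also have "\<dots> \<le> ennreal (2 * (?c * e)\<^sup>2 + 2 * (?c * e)\<^sup>2)"
      using N1[of n m] N2[of n m] that c
        step_norm_nonneg[OF H step_diff_in_step_tensors[OF XT XT]]
        step_norm_nonneg[OF H step_diff_in_step_tensors[OF YT YT]]
      by (intro ennreal_leI add_mono mult_left_mono power_mono) auto
    also have "2 * (?c * e)\<^sup>2 + 2 * (?c * e)\<^sup>2 = (2 * ?c * e)\<^sup>2" by (simp add: power2_eq_square)
    finally show ?thesis .
  qed
  show "\<exists>N. \<forall>n\<ge>N. norm (step_norm H (step_diff (X n) (Y n)) - 0) < r"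
  proof (intro exI allI impI)
    fix n assume n: "n \<ge> max N1 N2"
    \<comment> \<open>Fatou is applied in \<open>m\<close>, for a fixed \<open>n\<close>\<close>
    have lim: "liminf (\<lambda>m. ennreal ((Z n p - Z m p)\<^sup>2)) = ennreal ((Z n p)\<^sup>2)" for p
    proof (rule lim_imp_Liminf)
      have "(\<lambda>m. (Z n p - Z m p)\<^sup>2) \<longlonglongrightarrow> (Z n p - 0)\<^sup>2" by (intro tendsto_intros Z0)
      then show "(\<lambda>m. ennreal ((Z n p - Z m p)\<^sup>2)) \<longlonglongrightarrow> ennreal ((Z n p)\<^sup>2)"
        by (intro tendsto_ennrealI) simp
    qed simp
    have "ennreal ((?c * step_norm H (step_diff (X n) (Y n)))\<^sup>2) = (\<integral>\<^sup>+p. ennreal ((Z n p)\<^sup>2) \<partial>spectral2 H)"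
      by (simp add: Z_def nn_integral_hartley_diff_square[OF XT YT])
    also have "\<dots> = (\<integral>\<^sup>+p. liminf (\<lambda>m. ennreal ((Z n p - Z m p)\<^sup>2)) \<partial>spectral2 H)"
      by (simp add: lim)
    also have "\<dots> \<le> liminf (\<lambda>m. \<integral>\<^sup>+p. ennreal ((Z n p - Z m p)\<^sup>2) \<partial>spectral2 H)"
      by (intro nn_integral_liminf) measurable
    also have "\<dots> \<le> limsup (\<lambda>m. \<integral>\<^sup>+p. ennreal ((Z n p - Z m p)\<^sup>2) \<partial>spectral2 H)"
      by (intro Liminf_le_Limsup) simp
    also have "\<dots> \<le> ennreal ((2 * ?c * e)\<^sup>2)"
      using Cauchy n by (intro Limsup_bounded eventually_sequentiallyI[of "max N1 N2"]) auto
    finally have "(?c * step_norm H (step_diff (X n) (Y n)))\<^sup>2 \<le> (2 * ?c * e)\<^sup>2"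
      by (subst (asm) ennreal_le_iff) auto
    then have "?c * step_norm H (step_diff (X n) (Y n)) \<le> 2 * ?c * e"
      by (rule power2_le_imp_le) (use c e in auto)
    then have "step_norm H (step_diff (X n) (Y n)) \<le> 2 * e" using c by (simp add: mult.assoc)
    then show "norm (step_norm H (step_diff (X n) (Y n)) - 0) < r"
      using step_norm_nonneg[OF H step_diff_in_step_tensors[OF XT YT]] r by (simp add: e_def)
  qed
qed

section \<open>The tensor inner product as a limit\<close>

lemma represents_step_norm_bounded:
  assumes X: "represents H T X f"
  obtains K where "K > 0" "\<forall>\<^sub>F n in sequentially. step_norm H (X n) \<le> K"
proof -
  have XT: "X n \<in> step_tensors T" for n using X by (simp add: represents_def)
  obtain N where N: "\<And>m n. m \<ge> N \<Longrightarrow> n \<ge> N \<Longrightarrow> step_norm H (step_diff (X m) (X n)) < 1"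
    using X zero_less_one unfolding represents_def by metis
  have "step_norm H (X n) \<le> 1 + step_norm H (X N)" if "n \<ge> N" for n
    using step_norm_le_add_diff[OF H XT[of n] XT[of N]] N[OF that, of N] by simp
  moreover have "1 + step_norm H (X N) > 0" using step_norm_nonneg[OF H XT[of N]] by simp
  ultimately show ?thesis using that eventually_sequentially by blast
qed

lemma step_inner_representatives_diff:
  assumes T: "T \<ge> 0"
    and X: "represents H T X f" "represents H T X' f" and Y: "represents H T Y g" "represents H T Y' g"
  shows "(\<lambda>n. step_inner H (X n) (Y n) - step_inner H (X' n) (Y' n)) \<longlonglongrightarrow> 0"
proof -
  have tensors: "X n \<in> step_tensors T" "X' n \<in> step_tensors T" "Y n \<in> step_tensors T" "Y' n \<in> step_tensors T" for n
    using X Y by (simp_all add: represents_def)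
  obtain K where K: "\<forall>\<^sub>F n in sequentially. step_norm H (Y n) \<le> K"
    using represents_step_norm_bounded[OF Y(1)] by blast
  obtain L where L: "\<forall>\<^sub>F n in sequentially. step_norm H (X' n) \<le> L"
    using represents_step_norm_bounded[OF X(2)] by blast
  let ?x = "\<lambda>n. step_norm H (step_diff (X n) (X' n))" and ?y = "\<lambda>n. step_norm H (step_diff (Y n) (Y' n))"
  have "(\<lambda>n. ?x n * K + ?y n * L) \<longlonglongrightarrow> 0 * K + 0 * L"
    by (intro tendsto_intros represents_unique[OF T X] represents_unique[OF T Y])
  then have "(\<lambda>n. ?x n * K + ?y n * L) \<longlonglongrightarrow> 0" by simp
  moreover have "\<forall>\<^sub>F n in sequentially.
      norm (step_inner H (X n) (Y n) - step_inner H (X' n) (Y' n)) \<le> ?x n * K + ?y n * L"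
    using K L
  proof eventually_elim
    case (elim n)
    have "?x n * step_norm H (Y n) + ?y n * step_norm H (X' n) \<le> ?x n * K + ?y n * L"
      using elim step_norm_nonneg[OF H step_diff_in_step_tensors[OF tensors(1,2)], of n n]
        step_norm_nonneg[OF H step_diff_in_step_tensors[OF tensors(3,4)], of n n]
      by (intro add_mono mult_left_mono) auto
    with step_inner_perturb[OF H tensors(1,2,3,4), of n n n n] show ?case
      unfolding real_norm_def by linarith
  qed
  ultimately show ?thesis by (rule Lim_null_comparison[rotated])
qed

lemma step_inner_representatives_convergent:
  assumes X: "represents H T X f" and Y: "represents H T Y g"
  shows "convergent (\<lambda>n. step_inner H (X n) (Y n))"
proof -
  have tensors: "X n \<in> step_tensors T" "Y n \<in> step_tensors T" for n
    using X Y by (simp_all add: represents_def)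
  obtain K where K: "K > 0" "\<forall>\<^sub>F n in sequentially. step_norm H (Y n) \<le> K"
    using represents_step_norm_bounded[OF Y] by blast
  obtain L where L: "L > 0" "\<forall>\<^sub>F n in sequentially. step_norm H (X n) \<le> L"
    using represents_step_norm_bounded[OF X] by blast
  obtain N0 where N0: "\<And>n. n \<ge> N0 \<Longrightarrow> step_norm H (Y n) \<le> K \<and> step_norm H (X n) \<le> L"
    using eventually_conj[OF K(2) L(2)] unfolding eventually_sequentially by blast
  have "Cauchy (\<lambda>n. step_inner H (X n) (Y n))"
  proof (rule CauchyI)
    fix e :: real assume e: "0 < e"
    define d where "d = e / (K + L)"
    have d: "d > 0" using e K L by (simp add: d_def)
    obtain N1 where N1: "\<And>m n. m \<ge> N1 \<Longrightarrow> n \<ge> N1 \<Longrightarrow> step_norm H (step_diff (X m) (X n)) < d"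
      using X d unfolding represents_def by metis
    obtain N2 where N2: "\<And>m n. m \<ge> N2 \<Longrightarrow> n \<ge> N2 \<Longrightarrow> step_norm H (step_diff (Y m) (Y n)) < d"
      using Y d unfolding represents_def by metis
    show "\<exists>M. \<forall>m\<ge>M. \<forall>n\<ge>M. norm (step_inner H (X m) (Y m) - step_inner H (X n) (Y n)) < e"
    proof (intro exI[of _ "max N0 (max N1 N2)"] allI impI)
      fix m n assume mn: "max N0 (max N1 N2) \<le> m" "max N0 (max N1 N2) \<le> n"
      let ?x = "step_norm H (step_diff (X m) (X n))" and ?y = "step_norm H (step_diff (Y m) (Y n))"
      have nonneg: "0 \<le> ?x" "0 \<le> ?y"
        using step_norm_nonneg[OF H step_diff_in_step_tensors[OF tensors(1) tensors(1)]]
          step_norm_nonneg[OF H step_diff_in_step_tensors[OF tensors(2) tensors(2)]] by auto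
      have "\<bar>step_inner H (X m) (Y m) - step_inner H (X n) (Y n)\<bar> \<le> ?x * step_norm H (Y m) + ?y * step_norm H (X n)"
        using step_inner_perturb[OF H] tensors by blast
      also have "\<dots> \<le> ?x * K + ?y * L"
        using nonneg N0 mn by (intro add_mono mult_left_mono) auto
      also have "\<dots> < d * K + d * L"
        using N1[of m n] N2[of m n] mn K L by (intro add_strict_mono mult_strict_right_mono) auto
      also have "\<dots> = d * (K + L)" by (simp add: distrib_left)
      also have "\<dots> = e" using K L by (simp add: d_def)
      finally show "norm (step_inner H (X m) (Y m) - step_inner H (X n) (Y n)) < e" by simp
    qed
  qed
  then show ?thesis by (simp add: Cauchy_convergent)
qed

lemma tensor_inner_LIMSEQ:
  assumes T: "T \<ge> 0" and X: "represents H T X f" and Y: "represents H T Y g"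
  shows "(\<lambda>n. step_inner H (X n) (Y n)) \<longlonglongrightarrow> tensor_inner H T f g"
proof -
  obtain r where r: "(\<lambda>n. step_inner H (X n) (Y n)) \<longlonglongrightarrow> r"
    using step_inner_representatives_convergent[OF X Y] by (auto simp: convergent_def)
  have "tensor_inner H T f g = r"
    unfolding tensor_inner_def
  proof (rule the_equality)
    show "\<exists>X Y. represents H T X f \<and> represents H T Y g \<and> (\<lambda>n. step_inner H (X n) (Y n)) \<longlonglongrightarrow> r"
      using X Y r by blast
    fix s assume "\<exists>X Y. represents H T X f \<and> represents H T Y g \<and> (\<lambda>n. step_inner H (X n) (Y n)) \<longlonglongrightarrow> s"
    then obtain X' Y' where X': "represents H T X' f" and Y': "represents H T Y' g"
      and s: "(\<lambda>n. step_inner H (X' n) (Y' n)) \<longlonglongrightarrow> s" by blast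
    have "(\<lambda>n. step_inner H (X' n) (Y' n) - step_inner H (X n) (Y n)) \<longlonglongrightarrow> s - r"
      by (intro tendsto_diff s r)
    with step_inner_representatives_diff[OF T X' X Y' Y] have "s - r = 0" by (rule LIMSEQ_unique[symmetric])
    then show "s = r" by simp
  qed
  with r show ?thesis by simp
qed

section \<open>Membership by dominated convergence\<close>

text \<open>
  A dominated, pointwise convergent sequence of transforms converges in \<open>L\<^sup>2\<close> of the spectral measure,
  hence is Cauchy there; the embedding carries this back to the step tensors.
\<close>

lemma step_norm_diff_Cauchy_dominated:
  assumes XT: "\<And>n. X n \<in> step_tensors T"
    and bound: "\<And>n p. \<bar>hartley_step (X n) p\<bar> \<le> C * spectral_majorant p"
    and Cauchy: "\<And>p. Cauchy (\<lambda>n. hartley_step (X n) p)"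
    and e: "e > 0"
  shows "\<exists>N. \<forall>m\<ge>N. \<forall>n\<ge>N. step_norm H (step_diff (X m) (X n)) < e"
proof -
  let ?c = "spectral_const H"
  have c: "?c > 0" by (rule spectral_const_pos[OF H])
  define G where "G p = lim (\<lambda>n. hartley_step (X n) p)" for p
  have G: "(\<lambda>n. hartley_step (X n) p) \<longlonglongrightarrow> G p" for p
    unfolding G_def using Cauchy by (simp add: Cauchy_convergent convergent_LIMSEQ_iff[symmetric])
  have [measurable]: "G \<in> borel_measurable borel" unfolding G_def by measurable
  have Gb: "\<bar>G p\<bar> \<le> C * spectral_majorant p" for p
    by (rule LIMSEQ_le_const2[OF tendsto_rabs[OF G]]) (use bound in auto)
  have Db: "\<bar>hartley_step (X n) p - G p\<bar> \<le> (2 * C) * spectral_majorant p" for n p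
    using bound[of n p] Gb[of p] by simp
  have int: "integrable (spectral2 H) (\<lambda>p. (hartley_step (X n) p - G p)\<^sup>2)" for n
    unfolding power2_eq_square by (rule integrable_of_spectral_majorant_bounds[OF H _ _ Db Db]) measurable
  have "(\<lambda>n. \<integral>p. (hartley_step (X n) p - G p)\<^sup>2 \<partial>spectral2 H) \<longlonglongrightarrow> (\<integral>p. 0 \<partial>spectral2 H)"
  proof (rule integral_dominated_convergence[where w = "\<lambda>p. (2 * C)\<^sup>2 * (spectral_majorant p)\<^sup>2"])
    show "integrable (spectral2 H) (\<lambda>p. (2 * C)\<^sup>2 * (spectral_majorant p)\<^sup>2)"
      by (intro integrable_mult_right integrable_spectral_majorant_square[OF H])
    show "AE p in spectral2 H. (\<lambda>n. (hartley_step (X n) p - G p)\<^sup>2) \<longlonglongrightarrow> 0"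
    proof (rule AE_I2)
      fix p
      have "(\<lambda>n. (hartley_step (X n) p - G p)\<^sup>2) \<longlonglongrightarrow> (G p - G p)\<^sup>2" by (intro tendsto_intros G)
      then show "(\<lambda>n. (hartley_step (X n) p - G p)\<^sup>2) \<longlonglongrightarrow> 0" by simp
    qed
    fix n
    show "AE p in spectral2 H. norm ((hartley_step (X n) p - G p)\<^sup>2) \<le> (2 * C)\<^sup>2 * (spectral_majorant p)\<^sup>2"
    proof (rule AE_I2)
      fix p
      have "\<bar>hartley_step (X n) p - G p\<bar>\<^sup>2 \<le> ((2 * C) * spectral_majorant p)\<^sup>2"
        using Db by (rule power_mono) simp
      then show "norm ((hartley_step (X n) p - G p)\<^sup>2) \<le> (2 * C)\<^sup>2 * (spectral_majorant p)\<^sup>2"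
        by (simp add: power_mult_distrib)
    qed
  qed measurable
  then have "(\<lambda>n. \<integral>p. (hartley_step (X n) p - G p)\<^sup>2 \<partial>spectral2 H) \<longlonglongrightarrow> 0" by simp
  moreover have "(?c * e)\<^sup>2 / 4 > 0" using c e by simp
  ultimately obtain N where N: "\<And>n. n \<ge> N \<Longrightarrow>
      norm ((\<integral>p. (hartley_step (X n) p - G p)\<^sup>2 \<partial>spectral2 H) - 0) < (?c * e)\<^sup>2 / 4"
    using LIMSEQ_D by blast
  show ?thesis
  proof (intro exI[of _ N] allI impI)
    fix m n assume mn: "N \<le> m" "N \<le> n"
    have diff: "step_diff (X m) (X n) \<in> step_tensors T" by (intro step_diff_in_step_tensors XT)
    have "(?c * step_norm H (step_diff (X m) (X n)))\<^sup>2 =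
        (\<integral>p. (hartley_step (X m) p - hartley_step (X n) p)\<^sup>2 \<partial>spectral2 H)"
      unfolding power_mult_distrib step_norm_square[OF H diff] integral_hartley_step_mult[OF H diff diff, symmetric]
      by (simp add: hartley_step_diff power2_eq_square)
    also have "\<dots> \<le> (\<integral>p. 2 * (hartley_step (X m) p - G p)\<^sup>2 + 2 * (hartley_step (X n) p - G p)\<^sup>2 \<partial>spectral2 H)"
    proof (rule integral_mono)
      show "integrable (spectral2 H) (\<lambda>p. (hartley_step (X m) p - hartley_step (X n) p)\<^sup>2)"
        using integrable_hartley_step_mult[OF H, of "step_diff (X m) (X n)" "step_diff (X m) (X n)"]
        by (simp add: hartley_step_diff power2_eq_square)
      show "integrable (spectral2 H) (\<lambda>p. 2 * (hartley_step (X m) p - G p)\<^sup>2 + 2 * (hartley_step (X n) p - G p)\<^sup>2)"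
        using int by simp
      fix p
      show "(hartley_step (X m) p - hartley_step (X n) p)\<^sup>2 \<le> 2 * (hartley_step (X m) p - G p)\<^sup>2 + 2 * (hartley_step (X n) p - G p)\<^sup>2"
        using square_diff_le[of "hartley_step (X m) p" "hartley_step (X n) p" "G p"]
        by (simp add: power2_commute[of "G p"])
    qed
    also have "\<dots> = 2 * (\<integral>p. (hartley_step (X m) p - G p)\<^sup>2 \<partial>spectral2 H) + 2 * (\<integral>p. (hartley_step (X n) p - G p)\<^sup>2 \<partial>spectral2 H)"
      using int by simp
    also have "\<dots> < (?c * e)\<^sup>2"
      using N[OF mn(1)] N[OF mn(2)] by simp
    finally have "?c * step_norm H (step_diff (X m) (X n)) < ?c * e"
      by (rule power2_less_imp_less) (use c e in auto)
    then show "step_norm H (step_diff (X m) (X n)) < e" using c by simp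
  qed
qed

text \<open>
  Uniform approximation gives convergence in \<open>L\<^sup>2\<close> on the square, hence pointwise convergence of the
  transforms; the majorant then yields the Cauchy property in the stronger norm.
\<close>

lemma represents_by_uniform_approximation:
  assumes T: "T \<ge> 0" and XT: "\<And>n. X n \<in> step_tensors T"
    and f: "f \<in> borel_measurable borel"
    and err: "\<And>n p. p \<in> {0..<T} \<times> {0..<T} \<Longrightarrow> \<bar>f p - step_fun (X n) p\<bar> \<le> \<epsilon> n" and \<epsilon>: "\<epsilon> \<longlonglongrightarrow> 0"
    and bound: "\<And>n p. \<bar>hartley_step (X n) p\<bar> \<le> C * spectral_majorant p"
  shows "represents H T X f"
proof -
  let ?L = "lebesgue_on ({0..T} \<times> {0..T})"
  let ?d = "\<lambda>n. \<integral>\<^sup>+q. ennreal ((f q - step_fun (X n) q)\<^sup>2) \<partial>?L"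
  have fm: "f \<in> borel_measurable ?L" using f by (rule borel_measurable_lebesgue_on_borel)
  have le: "?d n \<le> ennreal ((\<epsilon> n)\<^sup>2 * T\<^sup>2)" for n
  proof -
    have "?d n \<le> (\<integral>\<^sup>+q. ennreal ((\<epsilon> n)\<^sup>2) * 1 \<partial>?L)"
    proof (rule nn_integral_mono_AE)
      show "AE q in ?L. ennreal ((f q - step_fun (X n) q)\<^sup>2) \<le> ennreal ((\<epsilon> n)\<^sup>2) * 1"
        using AE_lebesgue_on_square_open[of T]
      proof eventually_elim
        case (elim q)
        have "\<bar>f q - step_fun (X n) q\<bar>\<^sup>2 \<le> (\<epsilon> n)\<^sup>2" by (intro power_mono err elim) simp
        then show ?case by (simp add: ennreal_leI)
      qed
    qed
    also have "\<dots> = ennreal ((\<epsilon> n)\<^sup>2) * ennreal (T\<^sup>2)"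
      by (subst nn_integral_cmult, simp, subst emeasure_lebesgue_on_square[OF T], rule refl)
    finally show ?thesis by (simp add: ennreal_mult')
  qed
  have "(\<lambda>n. (\<epsilon> n)\<^sup>2 * T\<^sup>2) \<longlonglongrightarrow> 0\<^sup>2 * T\<^sup>2" by (intro tendsto_intros \<epsilon>)
  then have "(\<lambda>n. ennreal ((\<epsilon> n)\<^sup>2 * T\<^sup>2)) \<longlonglongrightarrow> 0"
    using tendsto_ennrealI[of "\<lambda>n. (\<epsilon> n)\<^sup>2 * T\<^sup>2" 0] by simp
  then have L2: "?d \<longlonglongrightarrow> 0"
    by (rule tendsto_sandwich[of "\<lambda>_. 0", OF _ _ tendsto_const, rotated 2]) (simp_all add: le)
  have "Cauchy (\<lambda>n. hartley_step (X n) p)" for p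
  proof -
    let ?K = "(4 * T * fst p * snd p)\<^sup>2"
    have pair: "((\<lambda>x. hartley_step (X (fst x)) p - hartley_step (X (snd x)) p) \<longlongrightarrow> 0) (sequentially \<times>\<^sub>F sequentially)"
    proof (rule tendsto_0_of_square_ennreal[OF hartley_step_diff_le_L2[OF T XT XT fm]])
      have "((\<lambda>x. ?d (fst x)) \<longlongrightarrow> 0) (sequentially \<times>\<^sub>F sequentially)"
        "((\<lambda>x. ?d (snd x)) \<longlongrightarrow> 0) (sequentially \<times>\<^sub>F sequentially)"
        by (rule filterlim_compose[OF L2] filterlim_fst filterlim_snd)+
      then have "((\<lambda>x. ennreal ?K * (2 * ?d (fst x) + 2 * ?d (snd x))) \<longlongrightarrow> ennreal ?K * (2 * 0 + 2 * 0)) (sequentially \<times>\<^sub>F sequentially)"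
        by (intro ennreal_tendsto_cmult tendsto_add) auto
      then show "((\<lambda>x. ennreal ?K * (2 * ?d (fst x) + 2 * ?d (snd x))) \<longlongrightarrow> 0) (sequentially \<times>\<^sub>F sequentially)" by simp
    qed
    show ?thesis
    proof (rule CauchyI)
      fix e :: real assume "0 < e"
      with pair have "\<forall>\<^sub>F x in sequentially \<times>\<^sub>F sequentially. \<bar>hartley_step (X (fst x)) p - hartley_step (X (snd x)) p\<bar> < e"
        by (auto dest: tendstoD simp: dist_real_def)
      then obtain N where "\<forall>m\<ge>N. \<forall>n\<ge>N. \<bar>hartley_step (X m) p - hartley_step (X n) p\<bar> < e"
        unfolding eventually_prod_sequentially by auto
      then show "\<exists>M. \<forall>m\<ge>M. \<forall>n\<ge>M. norm (hartley_step (X m) p - hartley_step (X n) p) < e" by auto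
    qed
  qed
  then have "\<forall>e>0. \<exists>N. \<forall>m\<ge>N. \<forall>n\<ge>N. step_norm H (step_diff (X m) (X n)) < e"
    using step_norm_diff_Cauchy_dominated[of X, OF XT bound] by blast
  then show ?thesis
    unfolding represents_def using XT fm L2 by blast
qed

end

section \<open>Step tensors with coefficients on a grid\<close>

definition grid_tensor :: "(nat \<Rightarrow> nat \<Rightarrow> real) \<Rightarrow> (nat \<Rightarrow> real \<times> real) \<Rightarrow> nat \<Rightarrow> step_tensor" where
  "grid_tensor c J n = map (\<lambda>(i, j). (c i j, J i, J j)) (List.product [0..<n] [0..<n])"

lemma sum_list_grid:
  fixes f :: "nat \<times> nat \<Rightarrow> real"
  shows "(\<Sum>p \<leftarrow> List.product [0..<n] [0..<n]. f p) = (\<Sum>i<n. \<Sum>j<n. f (i, j))"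
  by (simp add: sum_list_distinct_conv_sum_set distinct_product sum.cartesian_product atLeast0LessThan)

lemma hartley_step_grid: "hartley_step (grid_tensor c J n) p =
    (\<Sum>i<n. \<Sum>j<n. c i j * (hartley_incr (J i) (fst p) * hartley_incr (J j) (snd p)))"
  by (simp add: hartley_step_def grid_tensor_def o_def case_prod_unfold sum_list_grid)

lemma step_fun_grid: "step_fun (grid_tensor c J n) p =
    (\<Sum>i<n. \<Sum>j<n. c i j * (indicator {fst (J i)..<snd (J i)} (fst p) * indicator {fst (J j)..<snd (J j)} (snd p)))"
  by (simp add: step_fun_def grid_tensor_def o_def case_prod_unfold sum_list_grid)

lemma step_inner_grid: "step_inner H (grid_tensor c J n) (grid_tensor d K m) =
    (\<Sum>i<n. \<Sum>j<n. \<Sum>k<m. \<Sum>l<m. c i j * d k l * (interval_inner H (J i) (K k) * interval_inner H (J j) (K l)))"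
  by (simp add: step_inner_def grid_tensor_def o_def case_prod_unfold sum_list_grid)

lemma grid_tensor_in_step_tensors:
  assumes "\<And>i. i < n \<Longrightarrow> 0 \<le> fst (J i) \<and> fst (J i) \<le> snd (J i) \<and> snd (J i) \<le> T"
  shows "grid_tensor c J n \<in> step_tensors T"
  using assms by (auto simp: grid_tensor_def step_tensors_def case_prod_unfold)

section \<open>Elementary inequalities and geometric sums\<close>

text \<open>
  Concavity of \<open>z \<mapsto> z powr p\<close>. With \<open>p = 2H < 1\<close> it expresses the negative correlation of disjoint
  increments.
\<close>

lemma powr_increment_antimono:
  fixes x y d p :: real
  assumes "0 \<le> x" "x \<le> y" "0 \<le> d" "0 < p" "p \<le> 1"
  shows "(y + d) powr p - y powr p \<le> (x + d) powr p - x powr p"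
proof (rule DERIV_nonpos_imp_decreasing_open[OF assms(2)])
  fix z assume z: "x < z" "z < y"
  then have zpos: "z > 0" using assms by simp
  have "((\<lambda>z. (z + d) powr p - z powr p) has_real_derivative p * (z + d) powr (p - 1) - p * z powr (p - 1)) (at z)"
    using zpos assms by (auto intro!: derivative_eq_intros)
  moreover have "(z + d) powr (p - 1) \<le> z powr (p - 1)"
    using zpos assms by (intro powr_mono2') auto
  ultimately show "\<exists>y. ((\<lambda>z. (z + d) powr p - z powr p) has_real_derivative y) (at z) \<and> y \<le> 0"
    using assms by (intro exI conjI) (auto intro: mult_left_mono)
next
  show "continuous_on {x..y} (\<lambda>z. (z + d) powr p - z powr p)"
    using assms by (intro continuous_intros continuous_on_powr') auto
qed

lemma powr_le_one_plus:
  fixes z p :: real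
  assumes "0 \<le> z" "0 < p" "p \<le> 1"
  shows "z powr p \<le> 1 + z"
proof (cases "z \<le> 1")
  case True
  then have "z powr p \<le> 1" using assms by (intro powr_le1) auto
  then show ?thesis using assms by simp
next
  case False
  then have "z powr p \<le> z powr 1" using assms by (intro powr_mono) auto
  then show ?thesis using assms by simp
qed

lemma sum_abs_increments_valley:
  fixes g :: "nat \<Rightarrow> real"
  assumes "m \<le> N" and down: "\<And>i. i < m \<Longrightarrow> g (Suc i) \<le> g i"
    and up: "\<And>i. m \<le> i \<Longrightarrow> i < N \<Longrightarrow> g i \<le> g (Suc i)"
  shows "(\<Sum>i<N. \<bar>g (Suc i) - g i\<bar>) = g 0 + g N - 2 * g m"
  using assms(1) up
proof (induction N rule: dec_induct)
  case base
  have "(\<Sum>i<m. \<bar>g (Suc i) - g i\<bar>) = (\<Sum>i<m. g i - g (Suc i))"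
    using down by (intro sum.cong) auto
  also have "\<dots> = g 0 - g m" by (rule sum_lessThan_telescope')
  finally show ?case by simp
next
  case (step N)
  then show ?case by simp
qed

text \<open>
  Summation by parts for a sequence that jumps from 0 to 1 at \<open>k\<close> and decreases geometrically
  afterwards. Keeping the boundary term at \<open>N\<close> on the left makes the induction go
  through: the bound grows at each step by \<open>B\<close> times the decrease of the sequence.
\<close>

lemma sum_geometric_tail_increments_le:
  fixes E :: "nat \<Rightarrow> real"
  assumes "0 \<le> q" "q \<le> 1" and E: "\<And>i. \<bar>E i\<bar> \<le> B" and "k \<le> N"
  shows "\<bar>(\<Sum>i<N. (if k \<le> i then q ^ (i - k) else 0) * (E (Suc i) - E i)) - q ^ (N - k) * E N\<bar> \<le> B * (2 - q ^ (N - k))"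
  using \<open>k \<le> N\<close>
proof (induction N rule: dec_induct)
  case base
  then show ?case using E[of k] by simp
next
  case (step N)
  let ?S = "\<Sum>i<N. (if k \<le> i then q ^ (i - k) else 0) * (E (Suc i) - E i)"
  have pow: "q ^ (Suc N - k) = q * q ^ (N - k)" using step.hyps by (simp add: Suc_diff_le)
  have "q * q ^ (N - k) \<le> 1 * q ^ (N - k)" using assms by (intro mult_right_mono) auto
  then have nonneg: "0 \<le> q ^ (N - k) - q * q ^ (N - k)" by simp
  have "(\<Sum>i<Suc N. (if k \<le> i then q ^ (i - k) else 0) * (E (Suc i) - E i)) - q ^ (Suc N - k) * E (Suc N)
      = (?S - q ^ (N - k) * E N) + (q ^ (N - k) - q * q ^ (N - k)) * E (Suc N)"
    using step.hyps by (simp add: pow algebra_simps)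
  also have "\<bar>\<dots>\<bar> \<le> B * (2 - q ^ (N - k)) + (q ^ (N - k) - q * q ^ (N - k)) * B"
    using step.IH mult_left_mono[OF E[of "Suc N"] nonneg] nonneg
    by (intro order_trans[OF abs_triangle_ineq] add_mono) (auto simp: abs_mult)
  also have "\<dots> = B * (2 - q ^ (Suc N - k))" by (simp add: pow algebra_simps)
  finally show ?case .
qed

text \<open>
  The autoregressive form of the kernel: a stationary process with correlation \<open>q^|i-j|\<close> is
  \<open>\<Sum>k\<le>i. q^{i-k} Z k\<close> with independent \<open>Z k\<close>, of variance \<open>1\<close> for \<open>k = 0\<close> and \<open>1 - q\<^sup>2\<close> afterwards. The
  kernel thereby becomes a nonnegative combination of products.
\<close>

lemma geometric_kernel_decomposition:
  fixes q :: real
  assumes "i < N" "j < N"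
  shows "q ^ ((i - j) + (j - i)) = (\<Sum>k<N. (if k = 0 then 1 else 1 - q\<^sup>2) *
    ((if k \<le> i then q ^ (i - k) else 0) * (if k \<le> j then q ^ (j - k) else 0)))"
proof -
  have diag: "(\<Sum>k\<le>i. (if k = 0 then 1 else 1 - q\<^sup>2) * (q ^ (i - k) * q ^ (i + d - k))) = q ^ d" for i d
  proof (induction i)
    case (Suc i)
    have "(\<Sum>k\<le>Suc i. (if k = 0 then 1 else 1 - q\<^sup>2) * (q ^ (Suc i - k) * q ^ (Suc i + d - k))) =
        (\<Sum>k\<le>i. (if k = 0 then 1 else 1 - q\<^sup>2) * (q ^ (Suc i - k) * q ^ (Suc i + d - k))) + (1 - q\<^sup>2) * q ^ d"
      by simp
    also have "(\<Sum>k\<le>i. (if k = 0 then 1 else 1 - q\<^sup>2) * (q ^ (Suc i - k) * q ^ (Suc i + d - k))) =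
        (\<Sum>k\<le>i. q\<^sup>2 * ((if k = 0 then 1 else 1 - q\<^sup>2) * (q ^ (i - k) * q ^ (i + d - k))))"
      by (intro sum.cong) (auto simp: Suc_diff_le power2_eq_square algebra_simps)
    also have "\<dots> = q\<^sup>2 * q ^ d" by (simp add: sum_distrib_left[symmetric] Suc.IH)
    finally show ?case by (simp add: algebra_simps)
  qed simp
  have main: "(\<Sum>k<N. (if k = 0 then 1 else 1 - q\<^sup>2) *
      ((if k \<le> i then q ^ (i - k) else 0) * (if k \<le> j then q ^ (j - k) else 0))) = q ^ (j - i)"
    if "i \<le> j" "i < N" for i j
  proof -
    have "(\<Sum>k<N. (if k = 0 then 1 else 1 - q\<^sup>2) *
        ((if k \<le> i then q ^ (i - k) else 0) * (if k \<le> j then q ^ (j - k) else 0))) =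
        (\<Sum>k\<le>i. (if k = 0 then 1 else 1 - q\<^sup>2) * (q ^ (i - k) * q ^ (i + (j - i) - k)))"
      using that by (intro sum.mono_neutral_cong_right) auto
    then show ?thesis by (simp only: diag)
  qed
  show ?thesis
  proof (cases "i \<le> j")
    case True
    then show ?thesis using main[of i j] assms by simp
  next
    case False
    then show ?thesis using main[of j i] assms by (simp add: mult.commute)
  qed
qed

text \<open>
  The law of a geometric variable stopped at \<open>N\<close>. Its tail probabilities up to \<open>N\<close> are the powers of \<open>q\<close>
  (\<open>sum_tail_weight\<close>), which is how the exponential \<open>u\<close> is written as a mixture of indicators of
  intervals ending at \<open>T\<close>.
\<close>

definition tail_weight :: "real \<Rightarrow> nat \<Rightarrow> nat \<Rightarrow> real" where
  "tail_weight q N k = (if k < N then q ^ k - q ^ Suc k else q ^ N)"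

lemma tail_weight_nonneg: "0 \<le> q \<Longrightarrow> q \<le> 1 \<Longrightarrow> 0 \<le> tail_weight q N k"
  by (simp add: tail_weight_def mult_left_le_one_le)

lemma sum_tail_weight:
  assumes "m \<le> N"
  shows "(\<Sum>k<Suc N. tail_weight q N k * (if m \<le> k then 1 else 0)) = q ^ m"
proof -
  have "(\<Sum>k<N. tail_weight q N k * (if m \<le> k then 1 else 0)) = (\<Sum>k=m..<N. q ^ k - q ^ Suc k)"
    by (intro sum.mono_neutral_cong_right) (auto simp: tail_weight_def)
  also have "\<dots> = q ^ m - q ^ N"
    using assms sum_Suc_diff'[of m N "\<lambda>k. - (q ^ k)"] by simp
  finally show ?thesis using assms by (simp add: tail_weight_def)
qed

text \<open>
  The mean of the stopped geometric law is \<open>\<Sum>m=1..N. q^m\<close>, and the hypothesis is exactly what makes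
  \<open>x q^m \<le> q^{m-1} - q^m\<close>, so that the sum telescopes.
\<close>

lemma sum_tail_weight_index:
  assumes q: "0 \<le> q" "q * (1 + x) \<le> 1"
  shows "x * (\<Sum>k<Suc N. tail_weight q N k * real k) \<le> 1 - q ^ N"
proof -
  have "x * ((\<Sum>k<N. (q ^ k - q ^ Suc k) * real k) + q ^ N * real N) \<le> 1 - q ^ N"
  proof (induction N)
    case (Suc N)
    \<comment> \<open>the induction adds \<open>x q^(N+1)\<close> to the left and \<open>q^N - q^(N+1)\<close> to the right\<close>
    have "q ^ N * (q * (1 + x)) \<le> q ^ N * 1" using q by (intro mult_left_mono) auto
    then have "x * q ^ Suc N \<le> q ^ N - q ^ Suc N" by (simp add: algebra_simps)
    moreover have "x * ((\<Sum>k<Suc N. (q ^ k - q ^ Suc k) * real k) + q ^ Suc N * real (Suc N)) =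
        x * ((\<Sum>k<N. (q ^ k - q ^ Suc k) * real k) + q ^ N * real N) + x * q ^ Suc N"
      by (simp add: algebra_simps)
    ultimately show ?case using Suc.IH by linarith
  qed simp
  then show ?thesis by (simp add: tail_weight_def)
qed

lemma abs_exp_minus_diff_le:
  fixes x y :: real
  assumes "0 \<le> x" "0 \<le> y"
  shows "\<bar>exp (- x) - exp (- y)\<bar> \<le> \<bar>x - y\<bar>"
proof -
  have le: "exp (- u) - exp (- v) \<le> v - u" if "0 \<le> u" "u \<le> v" for u v :: real
  proof -
    have "exp (- u) - exp (- v) = exp (- u) * (1 - exp (- (v - u)))"
      by (simp add: right_diff_distrib flip: exp_add)
    also have "\<dots> \<le> 1 * (v - u)"
    proof (rule mult_mono)
      show "1 - exp (- (v - u)) \<le> v - u"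
        using exp_ge_add_one_self[of "- (v - u)"] by linarith
    qed (use that in auto)
    finally show ?thesis by simp
  qed
  show ?thesis
  proof (cases "x \<le> y")
    case True
    then show ?thesis using le[of x y] assms by (simp add: abs_if)
  next
    case False
    then show ?thesis using le[of y x] assms by (simp add: abs_if)
  qed
qed

section \<open>The discretised kernels\<close>

definition mesh :: "real \<Rightarrow> nat \<Rightarrow> real" where
  "mesh T N = T / real N"

definition cell :: "real \<Rightarrow> nat \<Rightarrow> nat \<Rightarrow> real \<times> real" where
  "cell T N i = (real i * mesh T N, real (Suc i) * mesh T N)"

definition tail :: "real \<Rightarrow> nat \<Rightarrow> nat \<Rightarrow> real \<times> real" where
  "tail T N k = (T - real k * mesh T N, T)"

definition decay :: "real \<Rightarrow> real \<Rightarrow> nat \<Rightarrow> real" where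
  "decay \<theta> T N = exp (- (\<theta> * mesh T N))"

text \<open>
  The kernel \<open>f\<close> sampled at the lower left corners of the cells: there it equals \<open>q^|i-j|\<close> for the decay
  \<open>q\<close> over one mesh, and \<open>(i - j) + (j - i)\<close> is \<open>|i - j|\<close> in truncated subtraction.
\<close>

definition f_steps :: "real \<Rightarrow> real \<Rightarrow> nat \<Rightarrow> step_tensor" where
  "f_steps \<theta> T N = grid_tensor (\<lambda>i j. decay \<theta> T N ^ ((i - j) + (j - i))) (cell T N) N"

text \<open>
  The kernel \<open>h\<close> sampled in the same way, but expanded in the intervals \<open>[T - k \<delta>, T)\<close>, with
  \<open>\<delta>\<close> the mesh, instead of the cells. In this form
  all coefficients are nonnegative with sum one, and \<open>u\<close> enters through the distance to \<open>T\<close>.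
\<close>

definition h_steps :: "real \<Rightarrow> real \<Rightarrow> nat \<Rightarrow> step_tensor" where
  "h_steps \<theta> T N = grid_tensor (\<lambda>k l. tail_weight (decay \<theta> T N) N k * tail_weight (decay \<theta> T N) N l) (tail T N) (Suc N)"

context
  fixes \<theta> T :: real and N :: nat
  assumes \<theta>: "\<theta> > 0" and T: "T > 0" and N: "N > 0"
begin

lemma mesh_pos: "mesh T N > 0"
  using T N by (simp add: mesh_def)

lemma N_mesh: "real N * mesh T N = T"
  using N by (simp add: mesh_def)

lemma decay_bounds: "0 < decay \<theta> T N" "decay \<theta> T N \<le> 1"
  using \<theta> mesh_pos by (simp_all add: decay_def)

lemma decay_power: "decay \<theta> T N ^ n = exp (- (\<theta> * (real n * mesh T N)))"
  by (simp add: decay_def exp_of_nat_mult[symmetric] algebra_simps)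

lemma grid_point_le: "i \<le> N \<Longrightarrow> real i * mesh T N \<le> T"
  using mult_right_mono[of "real i" "real N" "mesh T N"] mesh_pos N_mesh by simp

lemma f_steps_in: "f_steps \<theta> T N \<in> step_tensors T"
  unfolding f_steps_def
proof (rule grid_tensor_in_step_tensors)
  fix i assume "i < N"
  then have "real (Suc i) * mesh T N \<le> T" by (intro grid_point_le) simp
  then show "0 \<le> fst (cell T N i) \<and> fst (cell T N i) \<le> snd (cell T N i) \<and> snd (cell T N i) \<le> T"
    using mesh_pos by (simp add: cell_def)
qed

lemma h_steps_in: "h_steps \<theta> T N \<in> step_tensors T"
  unfolding h_steps_def
proof (rule grid_tensor_in_step_tensors)
  fix k assume "k < Suc N"
  then show "0 \<le> fst (tail T N k) \<and> fst (tail T N k) \<le> snd (tail T N k) \<and> snd (tail T N k) \<le> T"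
    using mesh_pos grid_point_le[of k] by (simp add: tail_def)
qed

lemma cell_exists:
  assumes "t \<in> {0..<T}"
  obtains i where "i < N" "real i * mesh T N \<le> t" "t < real (Suc i) * mesh T N"
proof -
  define i where "i = nat \<lfloor>t / mesh T N\<rfloor>"
  have "real i \<le> t / mesh T N" "t / mesh T N < real (Suc i)"
    using assms mesh_pos real_of_int_floor_add_one_gt[of "t / mesh T N"]
    by (simp_all add: i_def add.commute)
  then have i: "real i * mesh T N \<le> t" "t < real (Suc i) * mesh T N"
    using mesh_pos by (simp_all add: field_simps)
  have "real i * mesh T N < real N * mesh T N" using i(1) assms N_mesh by simp
  then have "i < N" using mesh_pos by simp
  with i show ?thesis using that by blast
qed

lemma mem_cell_iff:
  assumes "real i * mesh T N \<le> t" "t < real (Suc i) * mesh T N"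
  shows "t \<in> {fst (cell T N j)..<snd (cell T N j)} \<longleftrightarrow> j = i"
proof
  assume "t \<in> {fst (cell T N j)..<snd (cell T N j)}"
  then have "real j * mesh T N < real (Suc i) * mesh T N" "real i * mesh T N < real (Suc j) * mesh T N"
    using assms by (simp_all only: cell_def fst_conv snd_conv atLeastLessThan_iff) linarith+
  then have "real j < real (Suc i)" "real i < real (Suc j)" using mesh_pos by (simp_all only: mult_less_cancel_right_pos)
  then show "j = i" by simp
qed (use assms in \<open>simp add: cell_def\<close>)

lemma mem_tail_iff:
  assumes "i < N" "real i * mesh T N \<le> t" "t < real (Suc i) * mesh T N" "k \<le> N"
  shows "t \<in> {fst (tail T N k)..<snd (tail T N k)} \<longleftrightarrow> N - i \<le> k"
proof -
  have left: "T - real k * mesh T N = real (N - k) * mesh T N"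
    using N_mesh assms(4) by (simp add: of_nat_diff left_diff_distrib)
  have "t < T" using assms(3) grid_point_le[of "Suc i"] assms(1) by simp
  then have "t \<in> {fst (tail T N k)..<snd (tail T N k)} \<longleftrightarrow> real (N - k) * mesh T N \<le> t"
    by (simp add: tail_def left)
  also have "\<dots> \<longleftrightarrow> N - k \<le> i"
  proof
    assume "real (N - k) * mesh T N \<le> t"
    then have "real (N - k) * mesh T N < real (Suc i) * mesh T N" using assms by linarith
    then have "real (N - k) < real (Suc i)" using mesh_pos by (simp only: mult_less_cancel_right_pos)
    then show "N - k \<le> i" by simp
  next
    assume "N - k \<le> i"
    then have "real (N - k) * mesh T N \<le> real i * mesh T N" using mesh_pos by (intro mult_right_mono) auto
    then show "real (N - k) * mesh T N \<le> t" using assms by linarith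
  qed
  also have "\<dots> \<longleftrightarrow> N - i \<le> k" using assms by auto
  finally show ?thesis .
qed

lemma f_steps_error:
  assumes "p \<in> {0..<T} \<times> {0..<T}"
  shows "\<bar>f_kernel \<theta> T p - step_fun (f_steps \<theta> T N) p\<bar> \<le> 2 * \<theta> * mesh T N"
proof -
  obtain t s where p: "p = (t, s)" and t: "t \<in> {0..<T}" and s: "s \<in> {0..<T}" using assms by auto
  obtain i where i: "i < N" "real i * mesh T N \<le> t" "t < real (Suc i) * mesh T N" using cell_exists[OF t] .
  obtain j where j: "j < N" "real j * mesh T N \<le> s" "s < real (Suc j) * mesh T N" using cell_exists[OF s] .
  let ?q = "decay \<theta> T N"
  have "step_fun (f_steps \<theta> T N) p = (\<Sum>i'<N. \<Sum>j'<N. ?q ^ ((i' - j') + (j' - i')) *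
      ((if i' = i then 1 else 0) * (if j' = j then 1 else 0)))"
    unfolding f_steps_def step_fun_grid p fst_conv snd_conv indicator_def mem_cell_iff[OF i(2,3)] mem_cell_iff[OF j(2,3)]
    by (simp add: of_bool_def)
  also have "\<dots> = (\<Sum>i'<N. \<Sum>j'<N. if j' = j then (if i' = i then ?q ^ ((i' - j') + (j' - i')) else 0) else 0)"
    by (intro sum.cong refl) auto
  also have "\<dots> = ?q ^ ((i - j) + (j - i))"
    using i j by (simp add: sum.delta)
  also have "\<dots> = exp (- (\<theta> * (\<bar>real i - real j\<bar> * mesh T N)))"
  proof -
    have "real ((i - j) + (j - i)) = \<bar>real i - real j\<bar>" by (cases "i \<le> j") auto
    then show ?thesis by (simp only: decay_power)
  qed
  finally have step: "step_fun (f_steps \<theta> T N) p = exp (- (\<theta> * (\<bar>real i - real j\<bar> * mesh T N)))" .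
  have "\<bar>real i - real j\<bar> * mesh T N = \<bar>real i * mesh T N - real j * mesh T N\<bar>"
    using mesh_pos by (simp add: abs_mult left_diff_distrib[symmetric])
  then have dist: "\<bar>\<bar>t - s\<bar> - \<bar>real i - real j\<bar> * mesh T N\<bar> \<le> 2 * mesh T N"
    using i(2,3) j(2,3) by (simp add: distrib_right)
  have "f_kernel \<theta> T p = exp (- (\<theta> * \<bar>t - s\<bar>))"
    using t s by (simp add: f_kernel_def p indicator_def)
  then have "\<bar>f_kernel \<theta> T p - step_fun (f_steps \<theta> T N) p\<bar> \<le> \<bar>\<theta> * \<bar>t - s\<bar> - \<theta> * (\<bar>real i - real j\<bar> * mesh T N)\<bar>"
    unfolding step using \<theta> mesh_pos by (simp only:) (intro abs_exp_minus_diff_le, auto)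
  also have "\<dots> = \<theta> * \<bar>\<bar>t - s\<bar> - \<bar>real i - real j\<bar> * mesh T N\<bar>"
    using \<theta> by (simp add: abs_mult right_diff_distrib[symmetric])
  also have "\<dots> \<le> \<theta> * (2 * mesh T N)" using \<theta> dist by (intro mult_left_mono) auto
  finally show ?thesis by simp
qed

lemma h_steps_error:
  assumes "p \<in> {0..<T} \<times> {0..<T}"
  shows "\<bar>h_kernel \<theta> T p - step_fun (h_steps \<theta> T N) p\<bar> \<le> 2 * \<theta> * mesh T N"
proof -
  obtain t s where p: "p = (t, s)" and t: "t \<in> {0..<T}" and s: "s \<in> {0..<T}" using assms by auto
  obtain i where i: "i < N" "real i * mesh T N \<le> t" "t < real (Suc i) * mesh T N" using cell_exists[OF t] .
  obtain j where j: "j < N" "real j * mesh T N \<le> s" "s < real (Suc j) * mesh T N" using cell_exists[OF s] .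
  let ?q = "decay \<theta> T N"
  let ?w = "tail_weight ?q N"
  have ind: "indicator {fst (tail T N k)..<snd (tail T N k)} t = (if N - i \<le> k then 1 else 0 :: real)"
    "indicator {fst (tail T N k)..<snd (tail T N k)} s = (if N - j \<le> k then 1 else 0 :: real)" if "k < Suc N" for k
    using mem_tail_iff[OF i, of k] mem_tail_iff[OF j, of k] that by (simp_all add: indicator_def)
  have "step_fun (h_steps \<theta> T N) p = (\<Sum>k<Suc N. \<Sum>l<Suc N.
      (?w k * (if N - i \<le> k then 1 else 0)) * (?w l * (if N - j \<le> l then 1 else 0)))"
    unfolding h_steps_def step_fun_grid p fst_conv snd_conv
    by (intro sum.cong refl) (simp only: ind lessThan_iff mult_ac)
  also have "\<dots> = (\<Sum>k<Suc N. ?w k * (if N - i \<le> k then 1 else 0)) * (\<Sum>l<Suc N. ?w l * (if N - j \<le> l then 1 else 0))"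
    by (simp only: sum_product)
  also have "\<dots> = ?q ^ ((N - i) + (N - j))"
    by (simp only: sum_tail_weight[OF diff_le_self] power_add)
  also have "\<dots> = exp (- (\<theta> * (real ((N - i) + (N - j)) * mesh T N)))" by (rule decay_power)
  finally have step: "step_fun (h_steps \<theta> T N) p = exp (- (\<theta> * (real ((N - i) + (N - j)) * mesh T N)))" .
  have "real ((N - i) + (N - j)) * mesh T N = (real N * mesh T N - real i * mesh T N) + (real N * mesh T N - real j * mesh T N)"
    using i j by (simp add: of_nat_diff left_diff_distrib distrib_right)
  then have dist: "\<bar>(T - t) + (T - s) - real ((N - i) + (N - j)) * mesh T N\<bar> \<le> 2 * mesh T N"
    using i(2,3) j(2,3) unfolding N_mesh by (simp add: distrib_right)
  have "h_kernel \<theta> T p = exp (- (\<theta> * ((T - t) + (T - s))))"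
    using t s by (simp add: h_kernel_def p indicator_def algebra_simps)
  then have "\<bar>h_kernel \<theta> T p - step_fun (h_steps \<theta> T N) p\<bar> \<le>
      \<bar>\<theta> * ((T - t) + (T - s)) - \<theta> * (real ((N - i) + (N - j)) * mesh T N)\<bar>"
    unfolding step using \<theta> mesh_pos t s by (simp only:) (intro abs_exp_minus_diff_le, auto)
  also have "\<dots> = \<theta> * \<bar>(T - t) + (T - s) - real ((N - i) + (N - j)) * mesh T N\<bar>"
    using \<theta> by (simp add: abs_mult right_diff_distrib[symmetric])
  also have "\<dots> \<le> \<theta> * (2 * mesh T N)" using \<theta> dist by (intro mult_left_mono) auto
  finally show ?thesis by simp
qed

lemma abs_min_one_bound:
  fixes x \<xi> :: real
  assumes "x \<le> 4" "x \<le> 2 * T * \<bar>\<xi>\<bar>"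
  shows "x \<le> (4 + 2 * T) * min 1 \<bar>\<xi>\<bar>"
proof (cases "\<bar>\<xi>\<bar> \<le> 1")
  case True
  then show ?thesis using assms(2) by (simp add: min_def distrib_right)
next
  case False
  then show ?thesis using assms(1) T by (simp add: min_def)
qed

text \<open>
  The one-variable factors of the decomposed kernel have variation at most two, uniformly in the
  mesh. Summation by parts bounds their transforms at high frequencies, the length of \<open>[0,T]\<close> at low
  ones.
\<close>

lemma geometric_tail_hartley_le:
  assumes "k < N"
  shows "\<bar>\<Sum>i<N. (if k \<le> i then decay \<theta> T N ^ (i - k) else 0) * hartley_incr (cell T N i) \<xi>\<bar>
    \<le> (4 + 2 * T) * min 1 \<bar>\<xi>\<bar>"
proof (rule abs_min_one_bound)
  let ?q = "decay \<theta> T N"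
  let ?E = "\<lambda>i. cas (real i * mesh T N * \<xi>)"
  let ?a = "\<lambda>i. if k \<le> i then ?q ^ (i - k) else 0"
  have a: "0 \<le> ?a i" "?a i \<le> 1" for i
    using decay_bounds by (auto intro: power_le_one)
  have incr: "hartley_incr (cell T N i) \<xi> = ?E (Suc i) - ?E i" for i
    by (simp add: hartley_incr_def cell_def)
  have "\<bar>(\<Sum>i<N. ?a i * (?E (Suc i) - ?E i)) - ?q ^ (N - k) * ?E N\<bar> \<le> 2 * (2 - ?q ^ (N - k))"
    using decay_bounds assms by (intro sum_geometric_tail_increments_le abs_cas_le) auto
  moreover have "\<bar>?q ^ (N - k) * ?E N\<bar> \<le> ?q ^ (N - k) * 2"
    using decay_bounds abs_cas_le by (simp add: abs_mult)
  moreover have "\<bar>x\<bar> \<le> 4" if "\<bar>x - y\<bar> \<le> 2 * (2 - b)" "\<bar>y\<bar> \<le> b * 2" for x y b :: real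
    using that abs_triangle_ineq[of "x - y" y] by simp
  ultimately show "\<bar>\<Sum>i<N. ?a i * hartley_incr (cell T N i) \<xi>\<bar> \<le> 4"
    unfolding incr by blast
  have "\<bar>\<Sum>i<N. ?a i * hartley_incr (cell T N i) \<xi>\<bar> \<le> (\<Sum>i<N. 1 * (2 * (mesh T N * \<bar>\<xi>\<bar>)))"
  proof (rule order_trans[OF sum_abs sum_mono])
    fix i
    have "\<bar>?E (Suc i) - ?E i\<bar> \<le> 2 * \<bar>real (Suc i) * mesh T N * \<xi> - real i * mesh T N * \<xi>\<bar>"
      by (rule abs_cas_diff_le)
    also have "real (Suc i) * mesh T N * \<xi> - real i * mesh T N * \<xi> = mesh T N * \<xi>"
      by (simp add: algebra_simps)
    finally have "\<bar>hartley_incr (cell T N i) \<xi>\<bar> \<le> 2 * (mesh T N * \<bar>\<xi>\<bar>)"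
      unfolding incr using mesh_pos by (simp add: abs_mult)
    then show "\<bar>?a i * hartley_incr (cell T N i) \<xi>\<bar> \<le> 1 * (2 * (mesh T N * \<bar>\<xi>\<bar>))"
      unfolding abs_mult using a[of i] by (intro mult_mono) (auto simp: abs_of_nonneg)
  qed
  also have "\<dots> = 2 * (real N * mesh T N) * \<bar>\<xi>\<bar>" by simp
  finally show "\<bar>\<Sum>i<N. ?a i * hartley_incr (cell T N i) \<xi>\<bar> \<le> 2 * T * \<bar>\<xi>\<bar>" unfolding N_mesh .
qed

text \<open>
  Each product in the decomposition is dominated by a multiple of \<open>spectral_majorant\<close>, and the total weight
  \<open>1 + (N - 1) (1 - q\<^sup>2)\<close> stays below \<open>1 + 2 \<theta> T\<close> as the mesh is refined.
\<close>

lemma hartley_f_steps_le: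
  "\<bar>hartley_step (f_steps \<theta> T N) p\<bar> \<le> ((4 + 2 * T)\<^sup>2 * (1 + 2 * \<theta> * T)) * spectral_majorant p"
proof -
  let ?q = "decay \<theta> T N"
  let ?w = "\<lambda>k::nat. if k = 0 then 1 else 1 - ?q\<^sup>2"
  let ?a = "\<lambda>k i. if k \<le> i then ?q ^ (i - k) else 0"
  let ?A = "\<lambda>k \<xi>. \<Sum>i<N. ?a k i * hartley_incr (cell T N i) \<xi>"
  let ?B = "(4 + 2 * T)\<^sup>2 * spectral_majorant p"
  have B: "?B \<ge> 0" using spectral_majorant_nonneg by simp
  have "?q\<^sup>2 \<le> 1" using decay_bounds by (simp add: power_le_one)
  then have w: "0 \<le> ?w k" for k by simp
  have "hartley_step (f_steps \<theta> T N) p = (\<Sum>i<N. \<Sum>j<N. \<Sum>k<N. ?w k *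
      ((?a k i * hartley_incr (cell T N i) (fst p)) * (?a k j * hartley_incr (cell T N j) (snd p))))"
    unfolding f_steps_def hartley_step_grid
  proof (intro sum.cong refl)
    fix i j assume "i \<in> {..<N}" "j \<in> {..<N}"
    then have ij: "i < N" "j < N" by simp_all
    show "?q ^ ((i - j) + (j - i)) * (hartley_incr (cell T N i) (fst p) * hartley_incr (cell T N j) (snd p)) =
        (\<Sum>k<N. ?w k * ((?a k i * hartley_incr (cell T N i) (fst p)) * (?a k j * hartley_incr (cell T N j) (snd p))))"
      unfolding geometric_kernel_decomposition[OF ij] sum_distrib_right
      by (intro sum.cong refl) (simp only: mult_ac)
  qed
  also have "\<dots> = (\<Sum>i<N. \<Sum>k<N. \<Sum>j<N. ?w k *
      ((?a k i * hartley_incr (cell T N i) (fst p)) * (?a k j * hartley_incr (cell T N j) (snd p))))"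
    by (rule sum.cong[OF refl], rule sum.swap)
  also have "\<dots> = (\<Sum>k<N. \<Sum>i<N. \<Sum>j<N. ?w k *
      ((?a k i * hartley_incr (cell T N i) (fst p)) * (?a k j * hartley_incr (cell T N j) (snd p))))"
    by (rule sum.swap)
  also have "\<dots> = (\<Sum>k<N. ?w k * (?A k (fst p) * ?A k (snd p)))"
    unfolding sum_product by (simp only: sum_distrib_left)
  finally have "\<bar>hartley_step (f_steps \<theta> T N) p\<bar> = \<bar>\<Sum>k<N. ?w k * (?A k (fst p) * ?A k (snd p))\<bar>"
    by (rule arg_cong)
  also have "\<dots> \<le> (\<Sum>k<N. ?w k * ?B)"
  proof (rule order_trans[OF sum_abs sum_mono])
    fix k assume "k \<in> {..<N}"
    then have k: "k < N" by simp
    have "\<bar>?A k (fst p) * ?A k (snd p)\<bar> \<le> ((4 + 2 * T) * min 1 \<bar>fst p\<bar>) * ((4 + 2 * T) * min 1 \<bar>snd p\<bar>)"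
      unfolding abs_mult using T by (intro mult_mono geometric_tail_hartley_le[OF k]) auto
    also have "\<dots> = ?B" by (simp add: spectral_majorant_def power2_eq_square)
    finally show "\<bar>?w k * (?A k (fst p) * ?A k (snd p))\<bar> \<le> ?w k * ?B"
      unfolding abs_mult[of "?w k"] abs_of_nonneg[OF w] by (rule mult_left_mono[OF _ w])
  qed
  also have "\<dots> = (\<Sum>k<N. ?w k) * ?B"
    by (rule sum_distrib_right[symmetric])
  also have "\<dots> \<le> (1 + 2 * \<theta> * T) * ?B"
  proof (rule mult_right_mono[OF _ B])
    have "?q\<^sup>2 = exp (- (\<theta> * (2 * mesh T N)))" using decay_power[of 2] by simp
    then have "1 - ?q\<^sup>2 \<le> 2 * \<theta> * mesh T N"
      using exp_ge_add_one_self[of "- (\<theta> * (2 * mesh T N))"] by simp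
    then have "(\<Sum>k<N. ?w k) \<le> (\<Sum>k<N. (if k = 0 then 1 else 0) + 2 * \<theta> * mesh T N)"
      using \<theta> mesh_pos by (intro sum_mono) auto
    also have "\<dots> = 1 + 2 * \<theta> * (real N * mesh T N)"
      using N by (simp add: sum.distrib)
    finally show "(\<Sum>k<N. ?w k) \<le> 1 + 2 * \<theta> * T" unfolding N_mesh .
  qed
  finally show ?thesis by (simp only: mult_ac)
qed

lemma hartley_h_steps_le: "\<bar>hartley_step (h_steps \<theta> T N) p\<bar> \<le> (4 + 2 * T)\<^sup>2 * spectral_majorant p"
proof -
  let ?w = "tail_weight (decay \<theta> T N) N"
  let ?A = "\<lambda>\<xi>. \<Sum>k<Suc N. ?w k * hartley_incr (tail T N k) \<xi>"
  have w: "0 \<le> ?w k" for k using decay_bounds by (intro tail_weight_nonneg) auto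
  have A: "\<bar>?A \<xi>\<bar> \<le> (4 + 2 * T) * min 1 \<bar>\<xi>\<bar>" for \<xi>
  proof -
    have "\<bar>?A \<xi>\<bar> \<le> (\<Sum>k<Suc N. ?w k * ((4 + 2 * T) * min 1 \<bar>\<xi>\<bar>))"
    proof (rule order_trans[OF sum_abs sum_mono])
      fix k assume "k \<in> {..<Suc N}"
      then have "real k * mesh T N \<le> T" by (intro grid_point_le) simp
      then have "(4 + 2 * \<bar>T - (T - real k * mesh T N)\<bar>) * min 1 \<bar>\<xi>\<bar> \<le> (4 + 2 * T) * min 1 \<bar>\<xi>\<bar>"
        using mesh_pos by (intro mult_right_mono) auto
      with abs_hartley_incr_le[of "T - real k * mesh T N" T \<xi>]
      have "\<bar>hartley_incr (tail T N k) \<xi>\<bar> \<le> (4 + 2 * T) * min 1 \<bar>\<xi>\<bar>"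
        unfolding tail_def by linarith
      then show "\<bar>?w k * hartley_incr (tail T N k) \<xi>\<bar> \<le> ?w k * ((4 + 2 * T) * min 1 \<bar>\<xi>\<bar>)"
        unfolding abs_mult abs_of_nonneg[OF w] by (intro mult_left_mono w)
    qed
    also have "\<dots> = (\<Sum>k<Suc N. ?w k) * ((4 + 2 * T) * min 1 \<bar>\<xi>\<bar>)" by (rule sum_distrib_right[symmetric])
    also have "(\<Sum>k<Suc N. ?w k) = 1" using sum_tail_weight[of 0 N] by simp
    finally show ?thesis by simp
  qed
  have "hartley_step (h_steps \<theta> T N) p = ?A (fst p) * ?A (snd p)"
    unfolding h_steps_def hartley_step_grid sum_product
    by (intro sum.cong refl) (simp only: mult_ac)
  also have "\<bar>\<dots>\<bar> \<le> ((4 + 2 * T) * min 1 \<bar>fst p\<bar>) * ((4 + 2 * T) * min 1 \<bar>snd p\<bar>)"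
    unfolding abs_mult using T by (intro mult_mono A) auto
  also have "\<dots> = (4 + 2 * T)\<^sup>2 * spectral_majorant p" by (simp add: spectral_majorant_def power2_eq_square)
  finally show ?thesis .
qed

context
  fixes H :: real
  assumes H: "0 < H" "H < 1 / 2"
begin

section \<open>The bound on the inner product\<close>

text \<open>
  With \<open>r = T - k \<delta>\<close>, \<open>\<delta>\<close> the mesh, the covariance of \<open>B_t - B_0\<close> and \<open>B_T - B_r\<close> is, up to an additive constant, the
  function \<open>\<Phi>(t) = (|t - r|^{2H} - (T - t)^{2H}) / 2\<close>. By concavity it decreases up to \<open>r\<close>; afterwards it is
  a sum of two increasing terms. The sum of its absolute increments is thus
  \<open>\<Phi>(0) + \<Phi>(T) - 2 \<Phi>(r)\<close>, where \<open>\<Phi>(0) \<le> 0\<close> and \<open>\<Phi>(T) = - \<Phi>(r) = (T - r)^{2H} / 2\<close>.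
\<close>

lemma sum_abs_interval_inner_tail_le:
  assumes "k \<le> N"
  shows "(\<Sum>i<N. \<bar>interval_inner H (cell T N i) (tail T N k)\<bar>) \<le> 3 / 2 * (real k * mesh T N) powr (2 * H)"
proof -
  define r where "r = T - real k * mesh T N"
  define \<Phi> where "\<Phi> t = (\<bar>t - r\<bar> powr (2 * H) - (T - t) powr (2 * H)) / 2" for t
  define g where "g i = \<Phi> (real i * mesh T N)" for i
  have kd: "real k * mesh T N \<le> T" by (rule grid_point_le[OF assms])
  have r: "0 \<le> r" "r \<le> T" using kd mesh_pos by (simp_all add: r_def)
  have r_grid: "r = real (N - k) * mesh T N"
    using N_mesh assms by (simp add: r_def of_nat_diff left_diff_distrib)
  have incr: "interval_inner H (cell T N i) (tail T N k) = g (Suc i) - g i" if "i < N" for i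
  proof -
    have "real (Suc i) * mesh T N \<le> T" "real i * mesh T N \<le> T" using that by (intro grid_point_le; simp)+
    then show ?thesis
      unfolding cell_def tail_def g_def \<Phi>_def r_def[symmetric]
      using mesh_pos r by (subst interval_inner_eq_increments) (auto simp: field_simps abs_minus_commute)
  qed
  have decreasing: "\<Phi> b \<le> \<Phi> a" if "0 \<le> a" "a \<le> b" "b \<le> r" for a b
    using powr_increment_antimono[of "r - b" "r - a" "T - r" "2 * H"] that r H by (simp add: \<Phi>_def)
  have increasing: "\<Phi> a \<le> \<Phi> b" if "r \<le> a" "a \<le> b" "b \<le> T" for a b
  proof -
    have "(a - r) powr (2 * H) \<le> (b - r) powr (2 * H)" "(T - b) powr (2 * H) \<le> (T - a) powr (2 * H)"
      using that H by (intro powr_mono2; simp)+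
    then show ?thesis using that by (simp add: \<Phi>_def)
  qed
  have "(\<Sum>i<N. \<bar>interval_inner H (cell T N i) (tail T N k)\<bar>) = (\<Sum>i<N. \<bar>g (Suc i) - g i\<bar>)"
    using incr by simp
  also have "\<dots> = g 0 + g N - 2 * g (N - k)"
  proof (rule sum_abs_increments_valley)
    fix i assume "i < N - k"
    then have "real (Suc i) * mesh T N \<le> r" unfolding r_grid using mesh_pos by (intro mult_right_mono) auto
    then show "g (Suc i) \<le> g i" unfolding g_def using mesh_pos by (intro decreasing) auto
  next
    fix i assume "N - k \<le> i" "i < N"
    then have "r \<le> real i * mesh T N" "real (Suc i) * mesh T N \<le> T"
      unfolding r_grid using mesh_pos grid_point_le[of "Suc i"] by (auto intro!: mult_right_mono)
    then show "g i \<le> g (Suc i)" unfolding g_def using mesh_pos by (intro increasing) auto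
  qed simp
  also have "\<dots> \<le> 3 / 2 * (real k * mesh T N) powr (2 * H)"
  proof -
    have "g 0 \<le> 0"
      using r H powr_mono2[of "2 * H" r T] by (simp add: g_def \<Phi>_def)
    moreover have "g N = (T - r) powr (2 * H) / 2" using r by (simp add: g_def \<Phi>_def N_mesh)
    moreover have "g (N - k) = - ((T - r) powr (2 * H)) / 2" by (simp add: g_def \<Phi>_def r_grid[symmetric])
    moreover have "T - r = real k * mesh T N" by (simp add: r_def)
    ultimately show ?thesis by simp
  qed
  finally show ?thesis .
qed

text \<open>
  The coefficients of the first tensor lie in \<open>[0,1]\<close>. Bounding them by one decouples the two variables and
  leaves the square of the weighted variation, a bound in which neither \<open>T\<close> nor the mesh
  appears.
\<close>

lemma step_inner_f_h_le:
  "\<bar>step_inner H (f_steps \<theta> T N) (h_steps \<theta> T N)\<bar> \<le> (3 / 2 * (1 + 1 / \<theta>))\<^sup>2"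
proof -
  let ?q = "decay \<theta> T N"
  let ?w = "tail_weight ?q N"
  let ?I = "\<lambda>i k. \<bar>interval_inner H (cell T N i) (tail T N k)\<bar>"
  let ?S = "\<Sum>i<N. \<Sum>k<Suc N. ?w k * ?I i k"
  have w: "0 \<le> ?w k" for k using decay_bounds by (intro tail_weight_nonneg) auto
  have q1: "0 \<le> ?q ^ n" "?q ^ n \<le> 1" for n using decay_bounds by (auto intro: power_le_one)
  have "\<bar>step_inner H (f_steps \<theta> T N) (h_steps \<theta> T N)\<bar> \<le>
      (\<Sum>i<N. \<Sum>j<N. \<Sum>k<Suc N. \<Sum>l<Suc N. (?w k * ?I i k) * (?w l * ?I j l))"
    unfolding f_steps_def h_steps_def step_inner_grid
  proof (intro order_trans[OF sum_abs] sum_mono)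
    fix i j k l
    let ?r = "(?w k * ?w l) * (?I i k * ?I j l)"
    have "?q ^ ((i - j) + (j - i)) * ?r \<le> 1 * ?r"
      using w q1 by (intro mult_right_mono mult_nonneg_nonneg) auto
    then show "\<bar>?q ^ ((i - j) + (j - i)) * (?w k * ?w l) * (interval_inner H (cell T N i) (tail T N k) *
        interval_inner H (cell T N j) (tail T N l))\<bar> \<le> (?w k * ?I i k) * (?w l * ?I j l)"
      unfolding abs_mult abs_of_nonneg[OF w] abs_of_nonneg[OF q1(1)] by (simp only: mult_ac mult_1)
  qed
  also have "\<dots> = ?S\<^sup>2"
    by (simp only: power2_eq_square sum_product)
  also have "\<dots> \<le> (3 / 2 * (1 + 1 / \<theta>))\<^sup>2"
  proof (rule power_mono)
    show "0 \<le> ?S" by (intro sum_nonneg mult_nonneg_nonneg w abs_ge_zero)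
    have "?S = (\<Sum>k<Suc N. ?w k * (\<Sum>i<N. ?I i k))"
      by (subst sum.swap) (simp only: sum_distrib_left)
    also have "\<dots> \<le> (\<Sum>k<Suc N. ?w k * (3 / 2 * (1 + real k * mesh T N)))"
    proof (intro sum_mono mult_left_mono w)
      fix k assume "k \<in> {..<Suc N}"
      then have "(\<Sum>i<N. ?I i k) \<le> 3 / 2 * (real k * mesh T N) powr (2 * H)"
        by (intro sum_abs_interval_inner_tail_le) simp
      also have "\<dots> \<le> 3 / 2 * (1 + real k * mesh T N)"
        using H mesh_pos by (intro mult_left_mono powr_le_one_plus) auto
      finally show "(\<Sum>i<N. ?I i k) \<le> 3 / 2 * (1 + real k * mesh T N)" .
    qed
    also have "\<dots> = 3 / 2 * ((\<Sum>k<Suc N. ?w k) + mesh T N * (\<Sum>k<Suc N. ?w k * real k))"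
      by (simp only: sum_distrib_left sum.distrib[symmetric]) (intro sum.cong refl, simp only: algebra_simps)
    also have "(\<Sum>k<Suc N. ?w k) = 1" using sum_tail_weight[of 0 N] by simp
    also have "mesh T N * (\<Sum>k<Suc N. ?w k * real k) \<le> 1 / \<theta>"
    proof -
      have "?q * (1 + \<theta> * mesh T N) \<le> ?q * exp (\<theta> * mesh T N)"
        using decay_bounds exp_ge_add_one_self by (intro mult_left_mono) auto
      also have "\<dots> = 1" by (simp add: decay_def flip: exp_add)
      finally have "(\<theta> * mesh T N) * (\<Sum>k<Suc N. ?w k * real k) \<le> 1 - ?q ^ N"
        using decay_bounds by (intro sum_tail_weight_index) auto
      then have "\<theta> * (mesh T N * (\<Sum>k<Suc N. ?w k * real k)) \<le> 1"
        using q1[of N] by (simp only: mult.assoc)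
      then show ?thesis using \<theta> by (simp only: pos_le_divide_eq mult.commute)
    qed
    finally show "?S \<le> 3 / 2 * (1 + 1 / \<theta>)" by simp
  qed
  finally show ?thesis .
qed

end

end

section \<open>The uniform bound\<close>

theorem proposition1p5:
  fixes \<theta> H :: real
  assumes "\<theta> > 0" and "0 < H" and "H < 1/2"
  shows "\<exists>C::real. \<forall>T>0.
           f_kernel \<theta> T \<in> tensor_square H T \<and>
           h_kernel \<theta> T \<in> tensor_square H T \<and>
           \<bar>tensor_inner H T (f_kernel \<theta> T) (h_kernel \<theta> T)\<bar> \<le> C"
proof (intro exI[of _ "(3 / 2 * (1 + 1 / \<theta>))\<^sup>2"] allI impI)
  fix T :: real assume T: "0 < T"
  define X where "X n = f_steps \<theta> T (Suc n)" for n
  define Y where "Y n = h_steps \<theta> T (Suc n)" for n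
  note params = assms(1) T zero_less_Suc
  have "(\<lambda>n. 2 * \<theta> * (T / real (Suc n))) \<longlonglongrightarrow> 2 * \<theta> * 0"
    by (intro tendsto_intros LIMSEQ_Suc lim_const_over_n)
  then have err: "(\<lambda>n. 2 * \<theta> * mesh T (Suc n)) \<longlonglongrightarrow> 0" by (simp add: mesh_def)
  have f: "represents H T X (f_kernel \<theta> T)"
  proof (rule represents_by_uniform_approximation[OF assms(2,3) _ _ _ _ err])
    show "f_kernel \<theta> T \<in> borel_measurable borel"
      unfolding f_kernel_def borel_prod[symmetric] by measurable
    show "X n \<in> step_tensors T" for n
      unfolding X_def by (rule f_steps_in[OF params])
    show "\<bar>f_kernel \<theta> T p - step_fun (X n) p\<bar> \<le> 2 * \<theta> * mesh T (Suc n)" if "p \<in> {0..<T} \<times> {0..<T}" for n p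
      unfolding X_def by (rule f_steps_error[OF params that])
    show "\<bar>hartley_step (X n) p\<bar> \<le> ((4 + 2 * T)\<^sup>2 * (1 + 2 * \<theta> * T)) * spectral_majorant p" for n p
      unfolding X_def by (rule hartley_f_steps_le[OF params])
  qed (use T in simp)
  have h: "represents H T Y (h_kernel \<theta> T)"
  proof (rule represents_by_uniform_approximation[OF assms(2,3) _ _ _ _ err])
    show "h_kernel \<theta> T \<in> borel_measurable borel"
      unfolding h_kernel_def borel_prod[symmetric] by measurable
    show "Y n \<in> step_tensors T" for n
      unfolding Y_def by (rule h_steps_in[OF params])
    show "\<bar>h_kernel \<theta> T p - step_fun (Y n) p\<bar> \<le> 2 * \<theta> * mesh T (Suc n)" if "p \<in> {0..<T} \<times> {0..<T}" for n p
      unfolding Y_def by (rule h_steps_error[OF params that])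
    show "\<bar>hartley_step (Y n) p\<bar> \<le> (4 + 2 * T)\<^sup>2 * spectral_majorant p" for n p
      unfolding Y_def by (rule hartley_h_steps_le[OF params])
  qed (use T in simp)
  have "\<bar>tensor_inner H T (f_kernel \<theta> T) (h_kernel \<theta> T)\<bar> \<le> (3 / 2 * (1 + 1 / \<theta>))\<^sup>2"
  proof (rule LIMSEQ_le_const2[OF tendsto_rabs])
    show "(\<lambda>n. step_inner H (X n) (Y n)) \<longlonglongrightarrow> tensor_inner H T (f_kernel \<theta> T) (h_kernel \<theta> T)"
      using T by (intro tensor_inner_LIMSEQ[OF assms(2,3) _ f h]) simp
    show "\<exists>N. \<forall>n\<ge>N. \<bar>step_inner H (X n) (Y n)\<bar> \<le> (3 / 2 * (1 + 1 / \<theta>))\<^sup>2"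
      unfolding X_def Y_def using step_inner_f_h_le[OF params assms(2,3)] by blast
  qed
  with f h show "f_kernel \<theta> T \<in> tensor_square H T \<and> h_kernel \<theta> T \<in> tensor_square H T \<and>
      \<bar>tensor_inner H T (f_kernel \<theta> T) (h_kernel \<theta> T)\<bar> \<le> (3 / 2 * (1 + 1 / \<theta>))\<^sup>2"
    by (auto simp: tensor_square_def)
qed

end
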